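(* The Poincaré group $\mathrm{Poinc}$ has a decomposition of the form $$\mathrm{Poinc}\simeq\bigl(K\bowtie (AN)\bigr)\ltimes\mathbb{R}^4_+ ,$$ where $K$, $A$, $N$ are the subgroups of the Lorentz group $SO(3,1)$ given in the context. This decomposition is therefore represented by a maximal exclusive double group whose core is $(\mathbb{R}^4,+)$ and whose boundary groups are $SO(3)$ and $SO(1,1)\bowtie N$.
   Context: The Lorentz group $SO(3,1)$ is the group of linear transformations of $\mathbb{R}^4$ preserving the diagonal matrix $\mathrm{diag}(-1,1,1,1)$ (symmetries of Minkowski spacetime fixing the origin). The Poincaré group $\mathrm{Poinc}$ is the group of isometries of Minkowski spacetime, presented as the semi-direct product of the Lorentz group and the abelian group $\mathbb{R}^4_+=(\mathbb{R}^4,+)$ of translations. The subgroups appearing in the Iwasawa decomposition of $SO(3,1)$ are $$K=\exp\left\{\begin{bmatrix} 0 & 0 & 0 & 0 \\ 0 & 0 & a & b \\ 0 & -a & 0 & c \\ 0 & -b & -c & 0 \end{bmatrix}: a,b,c\in\mathbb{R}\right\}\simeq SO(3),$$ $$A=\exp\left\{\begin{bmatrix} 0 & a & 0 & 0 \\ {a} & 0 & 0 & 0 \\ 0 & 0 & 0 & 0 \\ 0 & 0 & 0 & 0 \end{bmatrix}: a\in\mathbb{R}\right\}\simeq SO(1,1),\qquad N=\exp\left\{\begin{bmatrix} 0 & 0 & a & b \\ 0 & 0 & a & b \\ {a} & -a & 0 & 0 \\ {b} & -b & 0 & 0 \end{bmatrix}: a,b\in\mathbb{R}\right\}.$$ For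 subgroups $P,Q$ of a group $L$, $L=P\bowtie Q$ (matched pair, bicrossed product) means that each element of $L$ can be uniquely written $pq$ with $p\in P$, $q\in Q$. A double group is a strict double category with one object (horizontal arrows, vertical arrows, and squares with horizontal and vertical compositions $\circ_h,\circ_v$ satisfying interchange) in which every square is invertible for both compositions. Its boundary groups are the groups of horizontal and of vertical arrows. Each square has left and right sides (horizontal source and target), which are vertical arrows, and top and bottom sides (vertical source and target), which are horizontal arrows. The core groupoid consists of the squares whose right and bottom sides are identities; the core bundle (the core) consists of the squares all of whose sides are identities, and is a group under composition. A double group is exclusive if its core groupoid and core bundle are identical, and maximal if any pair (vertical arrow, horizontal arrow) is the pair (right side, bottom side) of a square. A decomposition of a group as $(H\bowtie V)\ltimes T$ with $T$ abelian is represented by the double group with horizontal arrows $H$ and vertical arrows $V$, whose squares with top $h$, right side $v'$, left side $v$ and bottom $h'$ are the pairs $(hv'=vh',x)$ with $hv'=vh'$ in $H\bowtie V$ and $x\in T$, and with compositions $(hv'=vh',x)\circ_h(h''v''=v'h''',y)=((hh'')v''=v(h'h'''),\,x\,hyh^{-1})$ and $(hv'=vh',x)\circ_v(h'v'''=v''h'',y)=(h(v'v''')=(vv'')h'',\,x\,vyv^{-1})$, products and conjugations being taken in the whole group. Here $H=K$, $V=AN$ and $T=\mathbb{R}^4_+$.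
   Formalization: SO(3,1), SO(1,1), and hence Poinc, are taken with the identity component of the Lorentz group: for the full group of isometries of the form the decomposition fails, since −I preserves the form but is not in KAN. *)

theory Defs
  imports "HOL-Analysis.Analysis" "HOL-Algebra.Coset"
begin

section \<open>Group-theoretic decompositions\<close>

definition matched_pair :: "('a, 'b) monoid_scheme \<Rightarrow> 'a set \<Rightarrow> 'a set \<Rightarrow> bool" where
  "matched_pair L P Q \<longleftrightarrow>
     group L \<and> subgroup P L \<and> subgroup Q L \<and>
     (\<forall>l\<in>carrier L. \<exists>!pq. pq \<in> P \<times> Q \<and> l = fst pq \<otimes>\<^bsub>L\<^esub> snd pq)"

text \<open>The external semidirect product of \<open>G\<close> by \<open>T\<close>, with \<open>G\<close> acting on \<open>T\<close>; the pair \<open>(g, t)\<close>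
  stands for the product \<open>t g\<close>.\<close>

definition semidirect ::
    "('g, 'b) monoid_scheme \<Rightarrow> ('t, 'c) monoid_scheme \<Rightarrow> ('g \<Rightarrow> 't \<Rightarrow> 't) \<Rightarrow> ('g \<times> 't) monoid" where
  "semidirect G T act =
     \<lparr>carrier = carrier G \<times> carrier T,
      monoid.mult = (\<lambda>(g, s) (h, t). (g \<otimes>\<^bsub>G\<^esub> h, s \<otimes>\<^bsub>T\<^esub> act g t)),
      one = (\<one>\<^bsub>G\<^esub>, \<one>\<^bsub>T\<^esub>)\<rparr>"

text \<open>Internal decompositions \<open>G = (H \<bowtie> V) \<ltimes> T\<close> with \<open>T\<close> abelian.\<close>

definition group_decomposition :: "('a, 'b) monoid_scheme \<Rightarrow> 'a set \<Rightarrow> 'a set \<Rightarrow> 'a set \<Rightarrow> bool" where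
  "group_decomposition G H V T \<longleftrightarrow>
     group G \<and> subgroup (H <#>\<^bsub>G\<^esub> V) G \<and> matched_pair (G\<lparr>carrier := H <#>\<^bsub>G\<^esub> V\<rparr>) H V \<and>
     T \<lhd> G \<and> comm_group (G\<lparr>carrier := T\<rparr>) \<and>
     (H <#>\<^bsub>G\<^esub> V) \<inter> T = {\<one>\<^bsub>G\<^esub>} \<and> (H <#>\<^bsub>G\<^esub> V) <#>\<^bsub>G\<^esub> T = carrier G"


section \<open>Double groups\<close>

text \<open>Data of a strict double category with one object. Arrows compose in diagrammatic order.
  \<open>hid v\<close> is the identity for horizontal composition on the vertical arrow \<open>v\<close>, and \<open>vid h\<close> the
  identity for vertical composition on the horizontal arrow \<open>h\<close>. The compositions \<open>hcomp\<close> and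
  \<open>vcomp\<close> are only meaningful on composable pairs of squares.\<close>

record ('h, 'v, 's) double_data =
  hor :: "'h monoid"
  ver :: "'v monoid"
  squares :: "'s set"
  lside :: "'s \<Rightarrow> 'v"
  rside :: "'s \<Rightarrow> 'v"
  tside :: "'s \<Rightarrow> 'h"
  bside :: "'s \<Rightarrow> 'h"
  hcomp :: "'s \<Rightarrow> 's \<Rightarrow> 's"
  vcomp :: "'s \<Rightarrow> 's \<Rightarrow> 's"
  hid :: "'v \<Rightarrow> 's"
  vid :: "'h \<Rightarrow> 's"

locale one_object_double_category =
  fixes D :: "('h, 'v, 's) double_data"
  assumes monoid_hor: "monoid (hor D)"
    and monoid_ver: "monoid (ver D)"
    and sides: "a \<in> squares D \<Longrightarrow>
      lside D a \<in> carrier (ver D) \<and> rside D a \<in> carrier (ver D) \<and>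
      tside D a \<in> carrier (hor D) \<and> bside D a \<in> carrier (hor D)"
    and hcomp: "\<lbrakk>a \<in> squares D; b \<in> squares D; rside D a = lside D b\<rbrakk> \<Longrightarrow>
      hcomp D a b \<in> squares D \<and>
      lside D (hcomp D a b) = lside D a \<and> rside D (hcomp D a b) = rside D b \<and>
      tside D (hcomp D a b) = tside D a \<otimes>\<^bsub>hor D\<^esub> tside D b \<and>
      bside D (hcomp D a b) = bside D a \<otimes>\<^bsub>hor D\<^esub> bside D b"
    and vcomp: "\<lbrakk>a \<in> squares D; b \<in> squares D; bside D a = tside D b\<rbrakk> \<Longrightarrow>
      vcomp D a b \<in> squares D \<and>
      tside D (vcomp D a b) = tside D a \<and> bside D (vcomp D a b) = bside D b \<and>
      lside D (vcomp D a b) = lside D a \<otimes>\<^bsub>ver D\<^esub> lside D b \<and>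
      rside D (vcomp D a b) = rside D a \<otimes>\<^bsub>ver D\<^esub> rside D b"
    and hcomp_assoc: "\<lbrakk>a \<in> squares D; b \<in> squares D; c \<in> squares D;
        rside D a = lside D b; rside D b = lside D c\<rbrakk> \<Longrightarrow>
      hcomp D (hcomp D a b) c = hcomp D a (hcomp D b c)"
    and vcomp_assoc: "\<lbrakk>a \<in> squares D; b \<in> squares D; c \<in> squares D;
        bside D a = tside D b; bside D b = tside D c\<rbrakk> \<Longrightarrow>
      vcomp D (vcomp D a b) c = vcomp D a (vcomp D b c)"
    and hid: "v \<in> carrier (ver D) \<Longrightarrow>
      hid D v \<in> squares D \<and> lside D (hid D v) = v \<and> rside D (hid D v) = v \<and>
      tside D (hid D v) = \<one>\<^bsub>hor D\<^esub> \<and> bside D (hid D v) = \<one>\<^bsub>hor D\<^esub>"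
    and vid: "h \<in> carrier (hor D) \<Longrightarrow>
      vid D h \<in> squares D \<and> tside D (vid D h) = h \<and> bside D (vid D h) = h \<and>
      lside D (vid D h) = \<one>\<^bsub>ver D\<^esub> \<and> rside D (vid D h) = \<one>\<^bsub>ver D\<^esub>"
    and hcomp_hid: "a \<in> squares D \<Longrightarrow>
      hcomp D (hid D (lside D a)) a = a \<and> hcomp D a (hid D (rside D a)) = a"
    and vcomp_vid: "a \<in> squares D \<Longrightarrow>
      vcomp D (vid D (tside D a)) a = a \<and> vcomp D a (vid D (bside D a)) = a"
    and hid_mult: "\<lbrakk>v \<in> carrier (ver D); w \<in> carrier (ver D)\<rbrakk> \<Longrightarrow>
      hid D (v \<otimes>\<^bsub>ver D\<^esub> w) = vcomp D (hid D v) (hid D w)"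
    and vid_mult: "\<lbrakk>h \<in> carrier (hor D); k \<in> carrier (hor D)\<rbrakk> \<Longrightarrow>
      vid D (h \<otimes>\<^bsub>hor D\<^esub> k) = hcomp D (vid D h) (vid D k)"
    and hid_one: "hid D \<one>\<^bsub>ver D\<^esub> = vid D \<one>\<^bsub>hor D\<^esub>"
    and interchange: "\<lbrakk>a \<in> squares D; b \<in> squares D; c \<in> squares D; d \<in> squares D;
        rside D a = lside D b; rside D c = lside D d;
        bside D a = tside D c; bside D b = tside D d\<rbrakk> \<Longrightarrow>
      vcomp D (hcomp D a b) (hcomp D c d) = hcomp D (vcomp D a c) (vcomp D b d)"

locale double_group = one_object_double_category D
  for D :: "('h, 'v, 's) double_data" +
  assumes hcomp_inverse: "a \<in> squares D \<Longrightarrow> \<exists>b\<in>squares D.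
      lside D b = rside D a \<and> rside D b = lside D a \<and>
      hcomp D a b = hid D (lside D a) \<and> hcomp D b a = hid D (rside D a)"
    and vcomp_inverse: "a \<in> squares D \<Longrightarrow> \<exists>b\<in>squares D.
      tside D b = bside D a \<and> bside D b = tside D a \<and>
      vcomp D a b = vid D (tside D a) \<and> vcomp D b a = vid D (bside D a)"

definition core_groupoid :: "('h, 'v, 's) double_data \<Rightarrow> 's set" where
  "core_groupoid D = {a \<in> squares D. rside D a = \<one>\<^bsub>ver D\<^esub> \<and> bside D a = \<one>\<^bsub>hor D\<^esub>}"

definition core_bundle :: "('h, 'v, 's) double_data \<Rightarrow> 's set" where
  "core_bundle D = {a \<in> squares D. lside D a = \<one>\<^bsub>ver D\<^esub> \<and> rside D a = \<one>\<^bsub>ver D\<^esub> \<and>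
     tside D a = \<one>\<^bsub>hor D\<^esub> \<and> bside D a = \<one>\<^bsub>hor D\<^esub>}"

text \<open>On the core bundle \<open>hcomp\<close> and \<open>vcomp\<close> agree, by the Eckmann-Hilton argument.\<close>

definition core_group :: "('h, 'v, 's) double_data \<Rightarrow> 's monoid" where
  "core_group D =
     \<lparr>carrier = core_bundle D, monoid.mult = hcomp D, one = hid D \<one>\<^bsub>ver D\<^esub>\<rparr>"

definition exclusive :: "('h, 'v, 's) double_data \<Rightarrow> bool" where
  "exclusive D \<longleftrightarrow> core_groupoid D = core_bundle D"

definition maximal :: "('h, 'v, 's) double_data \<Rightarrow> bool" where
  "maximal D \<longleftrightarrow> (\<forall>v\<in>carrier (ver D). \<forall>h\<in>carrier (hor D).
     \<exists>a\<in>squares D. rside D a = v \<and> bside D a = h)"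

text \<open>The double group representing a decomposition \<open>G = (H \<bowtie> V) \<ltimes> T\<close>. The square
  \<open>(h v' = v h', x)\<close> is encoded as the tuple \<open>(h, v', v, h', x)\<close> of its top, right, left and bottom
  sides and its component in \<open>T\<close>.\<close>

definition decomposition_double_group ::
    "('a, 'b) monoid_scheme \<Rightarrow> 'a set \<Rightarrow> 'a set \<Rightarrow> 'a set \<Rightarrow>
     ('a, 'a, 'a \<times> 'a \<times> 'a \<times> 'a \<times> 'a) double_data" where
  "decomposition_double_group G H V T =
     \<lparr>hor = \<lparr>carrier = H, monoid.mult = (\<otimes>\<^bsub>G\<^esub>), one = \<one>\<^bsub>G\<^esub>\<rparr>,
      ver = \<lparr>carrier = V, monoid.mult = (\<otimes>\<^bsub>G\<^esub>), one = \<one>\<^bsub>G\<^esub>\<rparr>,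
      squares = {(h, v', v, h', x). h \<in> H \<and> v' \<in> V \<and> v \<in> V \<and> h' \<in> H \<and>
                   h \<otimes>\<^bsub>G\<^esub> v' = v \<otimes>\<^bsub>G\<^esub> h' \<and> x \<in> T},
      lside = (\<lambda>(h, v', v, h', x). v),
      rside = (\<lambda>(h, v', v, h', x). v'),
      tside = (\<lambda>(h, v', v, h', x). h),
      bside = (\<lambda>(h, v', v, h', x). h'),
      hcomp = (\<lambda>(h, v', v, h', x) (k, w', w, k', y).
                 (h \<otimes>\<^bsub>G\<^esub> k, w', v, h' \<otimes>\<^bsub>G\<^esub> k', x \<otimes>\<^bsub>G\<^esub> (h \<otimes>\<^bsub>G\<^esub> y \<otimes>\<^bsub>G\<^esub> inv\<^bsub>G\<^esub> h))),
      vcomp = (\<lambda>(h, v', v, h', x) (k, w', w, k', y).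
                 (h, v' \<otimes>\<^bsub>G\<^esub> w', v \<otimes>\<^bsub>G\<^esub> w, k', x \<otimes>\<^bsub>G\<^esub> (v \<otimes>\<^bsub>G\<^esub> y \<otimes>\<^bsub>G\<^esub> inv\<^bsub>G\<^esub> v))),
      hid = (\<lambda>v. (\<one>\<^bsub>G\<^esub>, v, v, \<one>\<^bsub>G\<^esub>, \<one>\<^bsub>G\<^esub>)),
      vid = (\<lambda>h. (h, \<one>\<^bsub>G\<^esub>, \<one>\<^bsub>G\<^esub>, h, \<one>\<^bsub>G\<^esub>))\<rparr>"


section \<open>Matrix groups\<close>

text \<open>The matrix exponential is written out as a power series, because the multiplication of the
  type \<open>real ^ 'n ^ 'n\<close>, which the library function \<open>exp\<close> would use, is componentwise.\<close>

definition mexp :: "real ^ 'n ^ 'n \<Rightarrow> real ^ 'n ^ 'n" where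
  "mexp X = (\<Sum>k. (1 / fact k) *\<^sub>R ((\<lambda>Y. X ** Y) ^^ k) (mat 1))"

definition matrix_group :: "(real ^ 'n ^ 'n) set \<Rightarrow> (real ^ 'n ^ 'n) monoid" where
  "matrix_group S = \<lparr>carrier = S, monoid.mult = (**), one = mat 1\<rparr>"

definition special_isometries :: "real ^ 'n ^ 'n \<Rightarrow> (real ^ 'n ^ 'n) set" where
  "special_isometries \<eta> = {M. transpose M ** \<eta> ** M = \<eta> \<and> det M = 1}"

text \<open>For an indefinite form \<open>special_isometries\<close> is disconnected, whereas the products \<open>K A N\<close> and
  the one-parameter group \<open>A\<close> below are connected. Hence \<open>SO(1,1)\<close> and \<open>SO(3,1)\<close> denote the
  identity components.\<close>

definition identity_component :: "(real ^ 'n ^ 'n) set \<Rightarrow> (real ^ 'n ^ 'n) set" where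
  "identity_component S = connected_component_set S (mat 1)"

definition eta11 :: "real ^ 2 ^ 2" where
  "eta11 = vector [vector [-1, 0], vector [0, 1]]"

definition eta31 :: "real ^ 4 ^ 4" where
  "eta31 = vector [vector [-1, 0, 0, 0],
                   vector [ 0, 1, 0, 0],
                   vector [ 0, 0, 1, 0],
                   vector [ 0, 0, 0, 1]]"

definition SO3 :: "(real ^ 3 ^ 3) monoid" where
  "SO3 = matrix_group (special_isometries (mat 1))"

definition SO11 :: "(real ^ 2 ^ 2) monoid" where
  "SO11 = matrix_group (identity_component (special_isometries eta11))"

definition Lorentz :: "(real ^ 4 ^ 4) monoid" where
  "Lorentz = matrix_group (identity_component (special_isometries eta31))"

definition Lorentz_K :: "(real ^ 4 ^ 4) set" where
  "Lorentz_K = {mexp (vector [vector [0,  0,  0, 0],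
                              vector [0,  0,  a, b],
                              vector [0, -a,  0, c],
                              vector [0, -b, -c, 0]]) | a b c. True}"

definition Lorentz_A :: "(real ^ 4 ^ 4) set" where
  "Lorentz_A = {mexp (vector [vector [0, a, 0, 0],
                              vector [a, 0, 0, 0],
                              vector [0, 0, 0, 0],
                              vector [0, 0, 0, 0]]) | a. True}"

definition Lorentz_N :: "(real ^ 4 ^ 4) set" where
  "Lorentz_N = {mexp (vector [vector [0,  0, a, b],
                              vector [0,  0, a, b],
                              vector [a, -a, 0, 0],
                              vector [b, -b, 0, 0]]) | a b. True}"

definition Lorentz_AN :: "(real ^ 4 ^ 4) set" where
  "Lorentz_AN = Lorentz_A <#>\<^bsub>Lorentz\<^esub> Lorentz_N"


section \<open>The Poincare group\<close>

type_synonym affine_map = "(real ^ 4 ^ 4) \<times> (real ^ 4)"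

definition R4 :: "(real ^ 4) monoid" where
  "R4 = \<lparr>carrier = UNIV, monoid.mult = (+), one = 0\<rparr>"

text \<open>The pair \<open>(M, t)\<close> is the isometry \<open>x \<mapsto> M x + t\<close>.\<close>

definition Poinc :: "affine_map monoid" where
  "Poinc = semidirect Lorentz R4 (*v)"

definition in_Poinc :: "(real ^ 4 ^ 4) set \<Rightarrow> affine_map set" where
  "in_Poinc S = S \<times> {0}"

definition Poinc_translations :: "affine_map set" where
  "Poinc_translations = {mat 1} \<times> UNIV"

definition Poinc_double_group ::
    "(affine_map, affine_map,
      affine_map \<times> affine_map \<times> affine_map \<times> affine_map \<times> affine_map) double_data" where
  "Poinc_double_group =
     decomposition_double_group Poinc (in_Poinc Lorentz_K) (in_Poinc Lorentz_AN) Poinc_translations"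

end

(* The first row of k a n, with k in K, a in A and n in N, is that of a n, and A N acts simply
   transitively on the unit timelike row vectors. So for each Lorentz transformation M there is
   exactly one b in A N with the same first row, and M b^-1 fixes time, that is, M b^-1 is a rotation
   of space. Hence the identity component of SO(3,1) is K A N with unique factors. It is cut out of
   all special isometries by the positivity of the time entry, whose square is at least 1.

   K is all of SO(3) because each rotation has an axis, and is the Rodrigues rotation about it.

   A square of a decomposition (H V) T is determined by a factorization h v' = v h' and an element
   of T. The interchange law holds because h v' = v h' and T is abelian; the double group is maximal
   because H V = V H and exclusive because H and V meet trivially. *)

theory Submission
  imports Defs
begin

section \<open>The double group of a decomposition\<close>

text \<open>The exponentials have closed forms because the generators, suitably scaled, satisfy Y^3
  = l Y with l = -1 for \<open>Lorentz_K\<close>, l = 1 for \<open>Lorentz_A\<close> and l = 0 for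
  \<open>Lorentz_N\<close>; one lemma on the series covers all three. Simple transitivity is
  explicit: the first row (p, q, y, z) is reached by exp t = p + q, a = y / (p + q), b = z / (p +
  q), and a positive time entry is what makes p + q positive. The identity component enters through
  two facts only: a curve of isometries through the identity stays in it, and a continuous entry
  that vanishes on no isometry keeps its sign on it. The inverse of an isometry M is eta M^T eta,
  which depends continuously on M and turns relations between the columns of M into relations
  between its rows.\<close>

lemma (in group) inv_cancel:
  assumes "g \<in> carrier G" "x \<in> carrier G"
  shows "inv g \<otimes> (g \<otimes> x) = x" "g \<otimes> (inv g \<otimes> x) = x"
  using assms by (simp_all flip: m_assoc)

text \<open>If h w = v k bounds a square, the conclusion bounds its horizontal inverse. The same
  rearrangement serves vertical inverses, maximality and uniqueness of factorizations.\<close>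

lemma (in group) swap_inv:
  assumes "h \<otimes> w = v \<otimes> k" "h \<in> carrier G" "w \<in> carrier G" "v \<in> carrier G" "k \<in> carrier G"
  shows "inv h \<otimes> v = w \<otimes> inv k"
proof -
  have "inv h \<otimes> v = inv h \<otimes> (v \<otimes> k \<otimes> inv k)"
    using assms(2-) by (simp add: m_assoc)
  also have "\<dots> = w \<otimes> inv k"
    using assms(2-) by (simp add: m_assoc inv_cancel flip: assms(1))
  finally show ?thesis .
qed

text \<open>Two factorizations p q = p' q' give p'^-1 p = q' q^-1, an element of both subgroups and
  hence trivial.\<close>

lemma (in group) matched_pairI:
  assumes "subgroup P G" "subgroup Q G" "P \<inter> Q = {\<one>}" "carrier G \<subseteq> P <#> Q"
  shows "matched_pair G P Q"
proof -
  have "p = p' \<and> q = q'"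
    if *: "p \<in> P" "q \<in> Q" "p' \<in> P" "q' \<in> Q" and eq: "p \<otimes> q = p' \<otimes> q'" for p q p' q'
  proof -
    have c: "p \<in> carrier G" "q \<in> carrier G" "p' \<in> carrier G" "q' \<in> carrier G"
      using * subgroup.subset[OF assms(1)] subgroup.subset[OF assms(2)] by auto
    have "inv p' \<otimes> p = q' \<otimes> inv q"
      using swap_inv[of p' q' p q] eq c by simp
    moreover have "inv p' \<otimes> p \<in> P" "q' \<otimes> inv q \<in> Q"
      using * assms(1,2) by (simp_all add: subgroup.m_closed subgroup.m_inv_closed)
    ultimately have "inv p' \<otimes> p = \<one>" "q' \<otimes> inv q = \<one>"
      using assms(3) by auto
    then show ?thesis
      using c by (metis inv_closed inv_equality inv_inv)
  qed
  moreover have "\<exists>pq. pq \<in> P \<times> Q \<and> l = fst pq \<otimes> snd pq" if "l \<in> carrier G" for l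
    using that assms(4) by (force simp: set_mult_def)
  ultimately have "\<exists>!pq. pq \<in> P \<times> Q \<and> l = fst pq \<otimes> snd pq" if "l \<in> carrier G" for l
    using that by (intro ex_ex1I) auto
  then show ?thesis
    unfolding matched_pair_def using assms(1,2) is_group by blast
qed

lemma (in group) conj_mult:
  assumes "g \<in> carrier G" "h \<in> carrier G" "x \<in> carrier G"
  shows "(g \<otimes> h) \<otimes> x \<otimes> inv (g \<otimes> h) = g \<otimes> (h \<otimes> x \<otimes> inv h) \<otimes> inv g"
  using assms by (simp add: inv_mult_group m_assoc)

lemma (in group) conj_distrib:
  assumes "g \<in> carrier G" "x \<in> carrier G" "y \<in> carrier G"
  shows "g \<otimes> (x \<otimes> y) \<otimes> inv g = (g \<otimes> x \<otimes> inv g) \<otimes> (g \<otimes> y \<otimes> inv g)"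
  using assms by (simp add: m_assoc inv_cancel)

text \<open>The consequences of a decomposition on which the double group rests. \<open>VH\<close>
  is the exchange of factors behind maximality, \<open>HV_triv\<close> gives exclusiveness, and
  \<open>T_comm\<close> gives interchange.\<close>

locale decomposed_group = group G for G (structure) +
  fixes H V T
  assumes H: "subgroup H G" and V: "subgroup V G" and T: "T \<lhd> G"
    and HV_triv: "H \<inter> V = {\<one>}"
    and VH: "\<And>v h. v \<in> V \<Longrightarrow> h \<in> H \<Longrightarrow> v \<otimes> h \<in> H <#> V"
    and T_comm: "\<And>x y. x \<in> T \<Longrightarrow> y \<in> T \<Longrightarrow> x \<otimes> y = y \<otimes> x"
begin

lemma mem_carrier [simp, intro]:
  "h \<in> H \<Longrightarrow> h \<in> carrier G" "v \<in> V \<Longrightarrow> v \<in> carrier G" "x \<in> T \<Longrightarrow> x \<in> carrier G"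
  using subgroup.subset[OF H] subgroup.subset[OF V] subgroup.subset[OF normal_imp_subgroup[OF T]]
  by auto

lemma mem_closed [simp]:
  "h \<in> H \<Longrightarrow> k \<in> H \<Longrightarrow> h \<otimes> k \<in> H" "v \<in> V \<Longrightarrow> w \<in> V \<Longrightarrow> v \<otimes> w \<in> V"
  "x \<in> T \<Longrightarrow> y \<in> T \<Longrightarrow> x \<otimes> y \<in> T"
  "h \<in> H \<Longrightarrow> inv h \<in> H" "v \<in> V \<Longrightarrow> inv v \<in> V" "x \<in> T \<Longrightarrow> inv x \<in> T"
  "\<one> \<in> H" "\<one> \<in> V" "\<one> \<in> T"
  using H V normal_imp_subgroup[OF T]
  by (simp_all add: subgroup.m_closed subgroup.m_inv_closed subgroup.one_closed)

lemma conj_T [simp]: "g \<in> carrier G \<Longrightarrow> x \<in> T \<Longrightarrow> g \<otimes> x \<otimes> inv g \<in> T"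
  using T by (simp add: normal_invE(2))

lemma conj_T' [simp]: "g \<in> carrier G \<Longrightarrow> x \<in> T \<Longrightarrow> g \<otimes> (x \<otimes> inv g) \<in> T"
  using conj_T[of g x] by (simp add: m_assoc)

lemma conj_inv_T: "g \<in> carrier G \<Longrightarrow> x \<in> T \<Longrightarrow> inv g \<otimes> (x \<otimes> g) \<in> T"
  using conj_T[of "inv g" x] by (simp add: m_assoc)

abbreviation "D \<equiv> decomposition_double_group G H V T"

text \<open>Pasting two squares along their common side \<open>s\<close> gives the boundary equation
  of the composite. Vertical composition reads it as it stands, horizontal composition with all
  three equations reversed.\<close>

lemma swap_assoc:
  assumes "p \<otimes> q = r \<otimes> s" "s \<otimes> t = u \<otimes> w"
    and "p \<in> carrier G" "q \<in> carrier G" "r \<in> carrier G" "s \<in> carrier G"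
      "t \<in> carrier G" "u \<in> carrier G" "w \<in> carrier G"
  shows "p \<otimes> (q \<otimes> t) = r \<otimes> (u \<otimes> w)"
proof -
  have "p \<otimes> (q \<otimes> t) = (p \<otimes> q) \<otimes> t"
    using assms(3-) by (simp add: m_assoc)
  also have "\<dots> = r \<otimes> (s \<otimes> t)"
    unfolding assms(1) using assms(3-) by (simp add: m_assoc)
  finally show ?thesis
    by (simp only: assms(2))
qed

lemma D_simps:
  "carrier (hor D) = H" "monoid.mult (hor D) = (\<otimes>)" "one (hor D) = \<one>"
  "carrier (ver D) = V" "monoid.mult (ver D) = (\<otimes>)" "one (ver D) = \<one>"
  "(h, v', v, h', x) \<in> squares D \<longleftrightarrow>
     h \<in> H \<and> v' \<in> V \<and> v \<in> V \<and> h' \<in> H \<and> h \<otimes> v' = v \<otimes> h' \<and> x \<in> T"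
  "lside D (h, v', v, h', x) = v" "rside D (h, v', v, h', x) = v'"
  "tside D (h, v', v, h', x) = h" "bside D (h, v', v, h', x) = h'"
  "hcomp D (h, v', v, h', x) (k, w', w, k', y) =
     (h \<otimes> k, w', v, h' \<otimes> k', x \<otimes> (h \<otimes> y \<otimes> inv h))"
  "vcomp D (h, v', v, h', x) (k, w', w, k', y) =
     (h, v' \<otimes> w', v \<otimes> w, k', x \<otimes> (v \<otimes> y \<otimes> inv v))"
  "hid D v = (\<one>, v, v, \<one>, \<one>)" "vid D h = (h, \<one>, \<one>, h, \<one>)"
  by (auto simp: decomposition_double_group_def)

lemma monoid_hor_D: "monoid (hor D)" and monoid_ver_D: "monoid (ver D)"
  by (auto intro!: monoidI simp: D_simps m_assoc)

text \<open>These are the \<open>T\<close> components of both sides of interchange. The innermost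
  factor \<open>u\<close> is conjugated by v h' on one side and by h v' on the other, which are the
  same element; it remains to exchange the conjugates of \<open>y\<close> and \<open>z\<close>,
  which lie in \<open>T\<close> by normality.\<close>

lemma comp_interchange:
  assumes "h \<otimes> v' = v \<otimes> h'" "h \<in> carrier G" "v' \<in> carrier G" "v \<in> carrier G" "h' \<in> carrier G"
    and "x \<in> T" "y \<in> T" "z \<in> T" "u \<in> T"
  shows "x \<otimes> (h \<otimes> y \<otimes> inv h) \<otimes> (v \<otimes> (z \<otimes> (h' \<otimes> u \<otimes> inv h')) \<otimes> inv v) =
    x \<otimes> (v \<otimes> z \<otimes> inv v) \<otimes> (h \<otimes> (y \<otimes> (v' \<otimes> u \<otimes> inv v')) \<otimes> inv h)"
proof -
  have eq: "v \<otimes> (h' \<otimes> u \<otimes> inv h') \<otimes> inv v = h \<otimes> (v' \<otimes> u \<otimes> inv v') \<otimes> inv h"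
    using assms by (simp flip: conj_mult)
  have swap: "x \<otimes> X \<otimes> (Z \<otimes> U) = x \<otimes> Z \<otimes> (X \<otimes> U)" if "X \<in> T" "Z \<in> T" "U \<in> T" for X Z U
  proof -
    have "X \<otimes> (Z \<otimes> U) = Z \<otimes> (X \<otimes> U)"
      using that T_comm[of X Z] by (simp flip: m_assoc)
    then show ?thesis
      using that assms by (simp add: m_assoc)
  qed
  have "x \<otimes> (h \<otimes> y \<otimes> inv h) \<otimes> (v \<otimes> (z \<otimes> (h' \<otimes> u \<otimes> inv h')) \<otimes> inv v) =
    x \<otimes> (h \<otimes> y \<otimes> inv h) \<otimes> ((v \<otimes> z \<otimes> inv v) \<otimes> (h \<otimes> (v' \<otimes> u \<otimes> inv v') \<otimes> inv h))"
    using assms by (simp only: conj_distrib eq mem_carrier conj_T)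
  also have "\<dots> = x \<otimes> (v \<otimes> z \<otimes> inv v) \<otimes> ((h \<otimes> y \<otimes> inv h) \<otimes> (h \<otimes> (v' \<otimes> u \<otimes> inv v') \<otimes> inv h))"
    using assms by (intro swap) simp_all
  also have "\<dots> = x \<otimes> (v \<otimes> z \<otimes> inv v) \<otimes> (h \<otimes> (y \<otimes> (v' \<otimes> u \<otimes> inv v')) \<otimes> inv h)"
    using assms by (simp only: conj_distrib mem_carrier conj_T)
  finally show ?thesis .
qed

lemma one_object_double_category_D: "one_object_double_category D"
proof (rule one_object_double_category.intro, goal_cases)
  case 1 show ?case by (rule monoid_hor_D)
next
  case 2 show ?case by (rule monoid_ver_D)
next
  case (3 a) then show ?case by (cases a) (simp add: D_simps)
next
  case (4 a b)
  then show ?case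
    by (cases a; cases b) (auto simp: D_simps m_assoc intro!: swap_assoc[OF sym sym, symmetric])
next
  case (5 a b)
  then show ?case
    by (cases a; cases b) (auto simp: D_simps m_assoc intro!: swap_assoc)
next
  case (6 a b c)
  then show ?case
    by (cases a; cases b; cases c) (auto simp: D_simps m_assoc inv_cancel inv_mult_group)
next
  case (7 a b c)
  then show ?case
    by (cases a; cases b; cases c) (auto simp: D_simps m_assoc inv_cancel inv_mult_group)
next
  case (8 v) then show ?case by (simp add: D_simps)
next
  case (9 h) then show ?case by (simp add: D_simps)
next
  case (10 a) then show ?case by (cases a) (auto simp: D_simps)
next
  case (11 a) then show ?case by (cases a) (auto simp: D_simps)
next
  case (12 v w) then show ?case by (simp add: D_simps)
next
  case (13 h k) then show ?case by (simp add: D_simps)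
next
  case 14 show ?case by (simp add: D_simps)
next
  case (15 a b c d)
  obtain h v' v h' x k w' w k' y l u' u l' z m t' t m' s
    where abcd: "a = (h, v', v, h', x)" "b = (k, w', w, k', y)"
      "c = (l, u', u, l', z)" "d = (m, t', t, m', s)"
    by (metis prod_cases5)
  \<comment> \<open>These identifications turn the sides that conjugate the component of
    \<open>d\<close> into the right and the bottom side of \<open>a\<close>.\<close>
  then have sq: "w = v'" "l = h'" and T: "x \<in> T" "y \<in> T" "z \<in> T" "s \<in> T"
    and c: "h \<in> carrier G" "v' \<in> carrier G" "v \<in> carrier G" "h' \<in> carrier G"
    and eq: "h \<otimes> v' = v \<otimes> h'"
    using 15 by (simp_all only: D_simps mem_carrier)
  show ?case
    unfolding abcd D_simps prod.inject sq by (intro conjI refl comp_interchange T c eq)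
qed

lemma double_group_D: "double_group D"
proof (rule double_group.intro[OF one_object_double_category_D double_group_axioms.intro], goal_cases)
  case (1 a)
  obtain h v' v h' x where a: "a = (h, v', v, h', x)" by (cases a)
  \<comment> \<open>The last component of the inverse solves x (h y h^-1) = 1 for y; the vertical
    case is the same with v for h.\<close>
  with 1 show ?case
    by (intro bexI[of _ "(inv h, v, v', inv h', inv h \<otimes> inv x \<otimes> inv (inv h))"])
      (auto simp: D_simps swap_inv conj_inv_T m_assoc inv_cancel)
next
  case (2 a)
  obtain h v' v h' x where a: "a = (h, v', v, h', x)" by (cases a)
  \<comment> \<open>The boundary of the vertical inverse, from the boundary equation read backwards
    as v h' = h v'.\<close>
  have "h' \<otimes> inv v' = inv v \<otimes> h"
    using 2 a swap_inv[of v h' h v'] by (simp add: D_simps)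
  with 2 a show ?case
    by (intro bexI[of _ "(h', inv v', inv v, h, inv v \<otimes> inv x \<otimes> inv (inv v))"])
      (auto simp: D_simps swap_inv conj_inv_T m_assoc inv_cancel)
qed

text \<open>A square with right side v and bottom h needs top and left sides with top v = left h.
  Rewriting v h^-1 as k w with k in \<open>H\<close> and w in \<open>V\<close> gives k^-1 v = w
  h.\<close>

lemma maximal_D: "maximal D"
  unfolding maximal_def D_simps
proof (intro ballI)
  fix v h assume vh: "v \<in> V" "h \<in> H"
  obtain k w where kw: "k \<in> H" "w \<in> V" "v \<otimes> inv h = k \<otimes> w"
    using VH[of v "inv h"] vh by (auto simp: set_mult_def)
  then have "(inv k, v, w, h, \<one>) \<in> squares D"
    using vh swap_inv[of k w v "inv h"] by (simp add: D_simps)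
  then show "\<exists>a\<in>squares D. rside D a = v \<and> bside D a = h"
    by (metis D_simps(9,11))
qed

text \<open>When right and bottom sides are trivial, the boundary equation says that the top equals
  the left side, so both lie in the intersection of \<open>H\<close> and \<open>V\<close>.\<close>

lemma exclusive_D: "exclusive D"
proof -
  have "v = \<one>" if "v \<in> H" "v \<in> V" for v
    using that HV_triv by auto
  then show ?thesis
    unfolding exclusive_def core_groupoid_def core_bundle_def by (auto simp: D_simps)
qed

text \<open>Over a trivial top side the conjugation in \<open>hcomp\<close> disappears and
  multiplication in \<open>T\<close> is left.\<close>

lemma core_D: "core_group D \<cong> G\<lparr>carrier := T\<rparr>"
proof -
  have "core_bundle D = (\<lambda>x. (\<one>, \<one>, \<one>, \<one>, x)) ` T"
    by (auto simp: core_bundle_def D_simps)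
  then have "(\<lambda>(h, v', v, h', x). x) \<in> iso (core_group D) (G\<lparr>carrier := T\<rparr>)"
    by (auto simp: iso_def hom_def core_group_def D_simps bij_betw_def inj_on_def image_image)
  then show ?thesis by (auto simp: is_iso_def)
qed

end

lemma decomposed_group_of_decomposition:
  assumes "group_decomposition G H V T"
  shows "decomposed_group G H V T"
proof -
  interpret group G using assms by (simp add: group_decomposition_def)
  let ?L = "G\<lparr>carrier := H <#>\<^bsub>G\<^esub> V\<rparr>"
  have L: "subgroup (H <#>\<^bsub>G\<^esub> V) G" and mp: "matched_pair ?L H V" and T: "T \<lhd> G"
    and T': "comm_group (G\<lparr>carrier := T\<rparr>)"
    using assms by (auto simp: group_decomposition_def)
  have H: "subgroup H G" and V: "subgroup V G"
    using L mp incl_subgroup by (auto simp: matched_pair_def)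
  show ?thesis
  proof (intro decomposed_group.intro decomposed_group_axioms.intro)
    have *: "pq = rs"
      if "pq \<in> H \<times> V" "rs \<in> H \<times> V" "fst pq \<otimes>\<^bsub>G\<^esub> snd pq = fst rs \<otimes>\<^bsub>G\<^esub> snd rs" for pq rs
    proof -
      have "fst pq \<otimes>\<^bsub>G\<^esub> snd pq \<in> carrier ?L"
        using that(1) unfolding set_mult_def by fastforce
      then have "\<exists>!rs. rs \<in> H \<times> V \<and> fst pq \<otimes>\<^bsub>G\<^esub> snd pq = fst rs \<otimes>\<^bsub>G\<^esub> snd rs"
        using mp by (simp add: matched_pair_def)
      then show ?thesis
        by (rule ex1E) (use that in blast)
    qed
    have 1: "\<one>\<^bsub>G\<^esub> \<in> H" "\<one>\<^bsub>G\<^esub> \<in> V"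
      using H V by (simp_all add: subgroup.one_closed)
    have "x = \<one>\<^bsub>G\<^esub>" if x: "x \<in> H" "x \<in> V" for x
    proof -
      have c: "x \<in> carrier G"
        using x subgroup.subset[OF H] by auto
      \<comment> \<open>An element of both subgroups factors as x 1 and as 1 x, so uniqueness of
        factorization makes it trivial.\<close>
      have "(x, \<one>\<^bsub>G\<^esub>) = (\<one>\<^bsub>G\<^esub>, x)"
      proof (rule *)
        show "(x, \<one>\<^bsub>G\<^esub>) \<in> H \<times> V" "(\<one>\<^bsub>G\<^esub>, x) \<in> H \<times> V"
          using x 1 by blast+
        show "fst (x, \<one>\<^bsub>G\<^esub>) \<otimes>\<^bsub>G\<^esub> snd (x, \<one>\<^bsub>G\<^esub>) = fst (\<one>\<^bsub>G\<^esub>, x) \<otimes>\<^bsub>G\<^esub> snd (\<one>\<^bsub>G\<^esub>, x)"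
          using c by simp
      qed
      then show ?thesis
        by (rule Pair_inject)
    qed
    then show "H \<inter> V = {\<one>\<^bsub>G\<^esub>}"
      using 1 by blast
    show "v \<otimes>\<^bsub>G\<^esub> h \<in> H <#>\<^bsub>G\<^esub> V" if "v \<in> V" "h \<in> H" for v h
    proof -
      have "subgroup V ?L" "subgroup H ?L"
        using mp by (auto simp: matched_pair_def)
      then have "v \<in> H <#>\<^bsub>G\<^esub> V" "h \<in> H <#>\<^bsub>G\<^esub> V"
        using that subgroup.subset[of V ?L] subgroup.subset[of H ?L] by auto
      then show ?thesis
        by (rule subgroup.m_closed[OF L])
    qed
    show "x \<otimes>\<^bsub>G\<^esub> y = y \<otimes>\<^bsub>G\<^esub> x" if "x \<in> T" "y \<in> T" for x y
      using that comm_groupE(4)[OF T'] by simp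
  qed (rule is_group H V T)+
qed

section \<open>Isometry groups and their identity components\<close>

lemma continuous_on_matrix_mult [continuous_intros]:
  fixes f :: "'a::topological_space \<Rightarrow> real^'n^'m" and g :: "'a \<Rightarrow> real^'k^'n"
  assumes "continuous_on S f" "continuous_on S g"
  shows "continuous_on S (\<lambda>x. f x ** g x)"
  unfolding matrix_matrix_mult_def using assms by (intro continuous_intros)

lemma continuous_on_transpose [continuous_intros]:
  fixes f :: "'a::topological_space \<Rightarrow> real^'n^'m"
  assumes "continuous_on S f"
  shows "continuous_on S (\<lambda>x. transpose (f x))"
  unfolding transpose_def using assms by (intro continuous_intros)

lemma special_isometries_mult:
  "x \<in> special_isometries \<eta> \<Longrightarrow> y \<in> special_isometries \<eta> \<Longrightarrow> x ** y \<in> special_isometries \<eta>"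
  by (simp add: special_isometries_def matrix_transpose_mul det_mul)
    (metis matrix_mul_assoc)

lemma mat_1_special_isometries [simp]: "mat 1 \<in> special_isometries \<eta>"
  by (simp add: special_isometries_def)

text \<open>Multiplying the isometry relation by eta exhibits the left inverse; for square matrices
  it is also a right inverse.\<close>

lemma isometry_inverse:
  fixes x :: "real^'n^'n"
  assumes "\<eta> ** \<eta> = mat 1" "transpose x ** \<eta> ** x = \<eta>"
  shows "(\<eta> ** transpose x ** \<eta>) ** x = mat 1" "x ** (\<eta> ** transpose x ** \<eta>) = mat 1"
proof -
  show "(\<eta> ** transpose x ** \<eta>) ** x = mat 1"
    using assms by (simp flip: matrix_mul_assoc)
  then show "x ** (\<eta> ** transpose x ** \<eta>) = mat 1"
    by (rule matrix_left_right_inverse[THEN iffD1])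
qed

lemma special_isometries_inverse:
  assumes "\<eta> ** \<eta> = mat 1" "x \<in> special_isometries \<eta>"
  shows "\<eta> ** transpose x ** \<eta> \<in> special_isometries \<eta>"
proof -
  let ?y = "\<eta> ** transpose x ** \<eta>"
  have x: "transpose x ** \<eta> ** x = \<eta>" "det x = 1"
    using assms(2) by (auto simp: special_isometries_def)
  have xy: "x ** ?y = mat 1"
    using isometry_inverse[OF assms(1) x(1)] by simp
  then have yx: "transpose ?y ** transpose x = mat 1"
    by (metis matrix_transpose_mul transpose_mat)
  have "transpose ?y ** \<eta> ** ?y = transpose ?y ** (transpose x ** \<eta> ** x) ** ?y"
    using x by simp
  also have "\<dots> = (transpose ?y ** transpose x) ** \<eta> ** (x ** ?y)"
    by (simp only: matrix_mul_assoc)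
  also have "\<dots> = \<eta>"
    unfolding xy yx by simp
  finally show ?thesis
    using arg_cong[OF xy, of det] x by (simp add: special_isometries_def det_mul)
qed

lemma identity_componentI:
  "connected T \<Longrightarrow> T \<subseteq> S \<Longrightarrow> mat 1 \<in> T \<Longrightarrow> x \<in> T \<Longrightarrow> x \<in> identity_component S"
  by (auto simp: identity_component_def connected_component_def)

lemma identity_componentE:
  assumes "x \<in> identity_component S"
  obtains T where "connected T" "T \<subseteq> S" "mat 1 \<in> T" "x \<in> T"
  using assms by (auto simp: identity_component_def connected_component_def)

lemma identity_component_subset: "identity_component S \<subseteq> S"
  by (auto simp: identity_component_def dest: connected_component_in)

lemma identity_component_path:
  fixes f :: "real \<Rightarrow> real^'n^'n"
  assumes "continuous_on UNIV f" "range f \<subseteq> S" "f s = mat 1"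
  shows "f t \<in> identity_component S"
  by (rule identity_componentI[of "range f"])
    (use assms in \<open>auto intro: connected_continuous_image simp flip: assms(3)\<close>)

text \<open>A connected set \<open>T\<close> joins the identity to x, and the translate by x of a
  connected set \<open>U\<close> joins x to x y; the two meet in x.\<close>

lemma identity_component_mult:
  assumes "x \<in> identity_component (special_isometries \<eta>)"
    and "y \<in> identity_component (special_isometries \<eta>)"
  shows "x ** y \<in> identity_component (special_isometries \<eta>)"
proof -
  obtain T where T: "connected T" "T \<subseteq> special_isometries \<eta>" "mat 1 \<in> T" "x \<in> T"
    using assms(1) by (rule identity_componentE)
  obtain U where U: "connected U" "U \<subseteq> special_isometries \<eta>" "mat 1 \<in> U" "y \<in> U"
    using assms(2) by (rule identity_componentE)
  have x: "x \<in> (\<lambda>u. x ** u) ` U"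
    using U by (auto intro!: image_eqI[of _ _ "mat 1"])
  show ?thesis
  proof (rule identity_componentI)
    have "connected ((\<lambda>u. x ** u) ` U)"
      using U by (intro connected_continuous_image continuous_intros)
    then show "connected (T \<union> (\<lambda>u. x ** u) ` U)"
      using T x by (intro connected_Un) auto
    show "T \<union> (\<lambda>u. x ** u) ` U \<subseteq> special_isometries \<eta>"
      using T U special_isometries_mult[of x \<eta>] by auto
  qed (use T U in auto)
qed

lemma identity_component_inverse:
  assumes "\<eta> ** \<eta> = mat 1" "x \<in> identity_component (special_isometries \<eta>)"
  shows "\<eta> ** transpose x ** \<eta> \<in> identity_component (special_isometries \<eta>)"
proof -
  obtain T where T: "connected T" "T \<subseteq> special_isometries \<eta>" "mat 1 \<in> T" "x \<in> T"
    using assms(2) by (rule identity_componentE)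
  show ?thesis
  proof (rule identity_componentI)
    show "connected ((\<lambda>u. \<eta> ** transpose u ** \<eta>) ` T)"
      using T by (intro connected_continuous_image continuous_intros)
    show "(\<lambda>u. \<eta> ** transpose u ** \<eta>) ` T \<subseteq> special_isometries \<eta>"
      using T special_isometries_inverse[OF assms(1)] by auto
    show "mat 1 \<in> (\<lambda>u. \<eta> ** transpose u ** \<eta>) ` T"
      using T assms(1) by (auto intro!: image_eqI[of _ _ "mat 1"])
  qed (use T in auto)
qed

lemma group_identity_component:
  assumes "\<eta> ** \<eta> = mat 1"
  shows "group (matrix_group (identity_component (special_isometries \<eta>)))"
proof (rule groupI)
  let ?G = "matrix_group (identity_component (special_isometries \<eta>))"
  fix x assume x: "x \<in> carrier ?G"
  then have "x \<in> special_isometries \<eta>"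
    using identity_component_subset by (auto simp: matrix_group_def)
  then show "\<exists>y\<in>carrier ?G. y \<otimes>\<^bsub>?G\<^esub> x = \<one>\<^bsub>?G\<^esub>"
    using isometry_inverse(1)[OF assms] identity_component_inverse[OF assms] x
    by (auto simp: matrix_group_def special_isometries_def)
qed (auto simp: matrix_group_def identity_component_mult matrix_mul_assoc
      intro!: identity_componentI[of "{mat 1}"])

text \<open>The entry equals 1 at the identity, so a nonpositive value would force a zero somewhere
  on a connected subset of \<open>S\<close>.\<close>

lemma identity_component_pos:
  fixes x :: "real^'n^'n"
  assumes "x \<in> identity_component S" "\<And>y. y \<in> S \<Longrightarrow> y $ i $ i \<noteq> 0"
  shows "x $ i $ i > 0"
proof (rule ccontr)
  assume "\<not> x $ i $ i > 0"
  obtain T where T: "connected T" "T \<subseteq> S" "mat 1 \<in> T" "x \<in> T"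
    using assms(1) by (rule identity_componentE)
  have "connected ((\<lambda>y. y $ i $ i) ` T)"
    using T by (intro connected_continuous_image continuous_intros)
  moreover have "x $ i $ i \<in> (\<lambda>y. y $ i $ i) ` T" "(1::real) \<in> (\<lambda>y. y $ i $ i) ` T"
    using T by (auto intro!: image_eqI[of _ _ "mat 1"] simp: mat_def)
  ultimately have "0 \<in> (\<lambda>y. y $ i $ i) ` T"
    using \<open>\<not> x $ i $ i > 0\<close> connectedD_interval[of _ "x $ i $ i" 1 0] by force
  then show False
    using T assms(2) by force
qed

section \<open>Exponentials of matrices with a cubic relation\<close>

text \<open>By the relation, Y^(2j+1) = l^j Y and Y^(2j+2) = l^j Y^2, so the series splits into the
  identity, a multiple of Y and a multiple of Y^2. The term k = 0 is the identity, which is why the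
  second scalar series leaves it out. Keeping both scalar series as parameters lets trigonometric,
  hyperbolic and polynomial coefficients share the argument.\<close>

lemma mexp_cubic:
  fixes Y :: "real^'n^'n"
  assumes Y: "Y ** (Y ** Y) = l *\<^sub>R Y"
    and p: "(\<lambda>k. if even k then 0 else l ^ ((k - 1) div 2) * r ^ k / fact k) sums p"
    and q: "(\<lambda>k. if even k \<and> k \<noteq> 0 then l ^ (k div 2 - 1) * r ^ k / fact k else 0) sums q"
  shows "mexp (r *\<^sub>R Y) = mat 1 + p *\<^sub>R Y + q *\<^sub>R (Y ** Y)"
proof -
  define X where "X = r *\<^sub>R Y"
  define P where "P k = ((\<lambda>Z. X ** Z) ^^ k) (mat 1)" for k
  have P_Suc: "P (Suc k) = X ** P k" for k
    by (simp add: P_def)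
  have *: "P (2 * j + 1) = (l ^ j * r ^ (2 * j + 1)) *\<^sub>R Y \<and>
    P (2 * j + 2) = (l ^ j * r ^ (2 * j + 2)) *\<^sub>R (Y ** Y)" for j
  proof (induction j)
    case 0
    have "P 1 = X" "P (Suc 1) = X ** X"
      by (simp_all add: P_def)
    then show ?case
      by (simp add: X_def matrix_scalar_ac scalar_matrix_assoc power2_eq_square)
  next
    case (Suc j)
    have 1: "P (2 * Suc j + 1) = (l ^ Suc j * r ^ (2 * Suc j + 1)) *\<^sub>R Y"
      using P_Suc[of "2 * j + 2"] Suc Y
      by (simp add: X_def matrix_scalar_ac flip: scalar_matrix_assoc)
    have "P (2 * Suc j + 2) = X ** P (2 * Suc j + 1)"
      using P_Suc[of "2 * Suc j + 1"] by simp
    then show ?case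
      unfolding 1 by (simp add: X_def matrix_scalar_ac flip: scalar_matrix_assoc)
  qed
  have "(1 / fact k) *\<^sub>R P k = (if k = 0 then mat 1 else 0)
      + (if even k then 0 else l ^ ((k - 1) div 2) * r ^ k / fact k) *\<^sub>R Y
      + (if even k \<and> k \<noteq> 0 then l ^ (k div 2 - 1) * r ^ k / fact k else 0) *\<^sub>R (Y ** Y)" for k
  proof (cases "k = 0")
    case True
    then show ?thesis by (simp add: P_def)
  next
    case False
    then obtain j where "k = 2 * j + 1 \<or> k = 2 * j + 2"
      by (metis One_nat_def add_2_eq_Suc' add_Suc_right even_Suc evenE nat.exhaust oddE)
    then show ?thesis
      using *[of j] by (elim disjE) simp_all
  qed
  moreover have "(\<lambda>k. (if k = 0 then mat 1 else 0)
      + (if even k then 0 else l ^ ((k - 1) div 2) * r ^ k / fact k) *\<^sub>R Y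
      + (if even k \<and> k \<noteq> 0 then l ^ (k div 2 - 1) * r ^ k / fact k else 0) *\<^sub>R (Y ** Y))
      sums (mat 1 + p *\<^sub>R Y + q *\<^sub>R (Y ** Y))"
    using p q by (intro sums_add sums_scaleR_left sums_single)
  ultimately have "(\<lambda>k. (1 / fact k) *\<^sub>R P k) sums (mat 1 + p *\<^sub>R Y + q *\<^sub>R (Y ** Y))"
    by simp
  then show ?thesis
    unfolding mexp_def X_def[symmetric] P_def by (rule sums_unique[symmetric])
qed

lemma mexp_rotation:
  assumes "Y ** (Y ** Y) = - Y"
  shows "mexp (r *\<^sub>R Y) = mat 1 + sin r *\<^sub>R Y + (1 - cos r) *\<^sub>R (Y ** Y)"
proof (rule mexp_cubic[of _ "-1"])
  show "(\<lambda>k. if even k then 0 else (- 1) ^ ((k - 1) div 2) * r ^ k / fact k) sums sin r"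
    using sin_converges[of r] by (rule sums_cong[THEN iffD1, rotated]) (auto simp: sin_coeff_def)
  \<comment> \<open>The exponent of -1 is one less than in the cosine series. This flips the sign,
    and removing the constant term leaves 1 - cos r.\<close>
  have *: "(- 1) ^ (b - Suc 0) = - ((- 1) ^ b :: real)" if "b > 0" for b
    using that by (cases b) auto
  have "(\<lambda>k. (if k = 0 then 1 else 0) - cos_coeff k *\<^sub>R r ^ k) sums (1 - cos r)"
    by (intro sums_diff cos_converges sums_single)
  then show "(\<lambda>k. if even k \<and> k \<noteq> 0 then (- 1) ^ (k div 2 - 1) * r ^ k / fact k else 0)
      sums (1 - cos r)"
    by (rule sums_cong[THEN iffD1, rotated]) (auto simp: cos_coeff_def * elim!: evenE)
qed (use assms in simp)

lemma mexp_boost: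
  assumes "Y ** (Y ** Y) = Y"
  shows "mexp (r *\<^sub>R Y) = mat 1 + sinh r *\<^sub>R Y + (cosh r - 1) *\<^sub>R (Y ** Y)"
proof (rule mexp_cubic[of _ 1])
  show "(\<lambda>k. if even k then 0 else 1 ^ ((k - 1) div 2) * r ^ k / fact k) sums sinh r"
    using sinh_converges[of r] by (rule sums_cong[THEN iffD1, rotated]) (auto simp: divide_inverse_commute)
  have "(\<lambda>k. (if even k then r ^ k /\<^sub>R fact k else 0) - (if k = 0 then 1 else 0)) sums (cosh r - 1)"
    by (intro sums_diff cosh_converges sums_single)
  then show "(\<lambda>k. if even k \<and> k \<noteq> 0 then 1 ^ (k div 2 - 1) * r ^ k / fact k else 0)
      sums (cosh r - 1)"
    by (rule sums_cong[THEN iffD1, rotated]) (auto simp: divide_inverse_commute)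
qed (use assms in simp)

lemma mexp_nilpotent:
  assumes "Y ** (Y ** Y) = 0"
  shows "mexp Y = mat 1 + Y + (1/2) *\<^sub>R (Y ** Y)"
proof -
  have "mexp (1 *\<^sub>R Y) = mat 1 + 1 *\<^sub>R Y + (1/2) *\<^sub>R (Y ** Y)"
  \<comment> \<open>Since \<open>0 ^ 0 = 1\<close>, only the terms k = 1 and k = 2 survive.\<close>
  proof (rule mexp_cubic[of _ 0])
    show "(\<lambda>k. if even k then 0 else 0 ^ ((k - 1) div 2) * 1 ^ k / fact k) sums (1::real)"
      using sums_single[of 1 "\<lambda>_. 1::real"]
      by (rule sums_cong[THEN iffD1, rotated]) (auto simp: power_0_left; presburger)
    show "(\<lambda>k. if even k \<and> k \<noteq> 0 then 0 ^ (k div 2 - 1) * 1 ^ k / fact k else 0) sums (1/2::real)"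
      using sums_single[of 2 "\<lambda>_. 1/2::real"]
      by (rule sums_cong[THEN iffD1, rotated]) (auto simp: power_0_left fact_2 elim!: evenE)
  qed (use assms in simp)
  then show ?thesis by simp
qed

section \<open>Rotations of three-space\<close>

definition cross_matrix :: "real^3 \<Rightarrow> real^3^3" where
  "cross_matrix u = vector [vector [0, - u$3, u$2], vector [u$3, 0, - u$1], vector [- u$2, u$1, 0]]"

text \<open>The value of \<open>mexp_rotation\<close> at the generator
  \<open>cross_matrix u\<close>; for a unit vector \<open>u\<close> it is the rotation about
  \<open>u\<close> by the angle \<open>t\<close>.\<close>

definition rodrigues :: "real^3 \<Rightarrow> real \<Rightarrow> real^3^3" where
  "rodrigues u t = mat 1 + sin t *\<^sub>R cross_matrix u
     + (1 - cos t) *\<^sub>R (cross_matrix u ** cross_matrix u)"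

lemma cross_matrix_mult: "cross_matrix u *v x = cross3 u x"
  by (simp add: cross_matrix_def cross3_def matrix_vector_mult_def vec_eq_iff forall_3 sum_3)

lemma uminus_matrix_vector_mult: "(- A) *v x = - (A *v x)" for A :: "real^'n^'m"
  by (simp add: matrix_vector_mult_def vec_eq_iff sum_negf)

text \<open>In the triple product formula for u x (u x w), with w = u x x, the term along
  \<open>u\<close> drops out because w is orthogonal to \<open>u\<close>.\<close>

lemma cross_matrix_cubed:
  assumes "norm u = 1"
  shows "cross_matrix u ** (cross_matrix u ** cross_matrix u) = - cross_matrix u"
proof -
  have "u \<bullet> u = 1"
    using assms by (simp add: dot_square_norm)
  have "cross3 u (cross3 u (cross3 u x)) = - cross3 u x" for x
    unfolding Lagrange[of u u "cross3 u x"] using \<open>u \<bullet> u = 1\<close> by (simp add: dot_cross_self)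
  then show ?thesis
    unfolding matrix_eq by (simp add: cross_matrix_mult uminus_matrix_vector_mult flip: matrix_vector_mul_assoc)
qed

lemma rodrigues_mult: "rodrigues u t *v x = x + sin t *\<^sub>R cross3 u x + (1 - cos t) *\<^sub>R cross3 u (cross3 u x)"
  by (simp add: rodrigues_def matrix_vector_mult_add_rdistrib cross_matrix_mult
      flip: scaleR_matrix_vector_assoc matrix_vector_mul_assoc)

text \<open>Applied to a vector, the cubic relation leaves only x, u x x and u x (u x x), whose
  coefficients agree by the addition formulas.\<close>

lemma rodrigues_add:
  assumes "norm u = 1"
  shows "rodrigues u s ** rodrigues u t = rodrigues u (s + t)"
proof -
  have *: "cross3 u (cross3 u (cross3 u x)) = - cross3 u x" for x
    using arg_cong[OF cross_matrix_cubed[OF assms], of "\<lambda>M. M *v x"]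
    by (simp add: cross_matrix_mult uminus_matrix_vector_mult flip: matrix_vector_mul_assoc)
  show ?thesis
    unfolding matrix_eq matrix_vector_mul_assoc[symmetric] rodrigues_mult
    by (simp add: cross_add_right Cross3.right_diff_distrib cross_mult_right * sin_add cos_add algebra_simps)
qed

lemma rodrigues_0 [simp]: "rodrigues u 0 = mat 1"
  by (simp add: rodrigues_def)

text \<open>The cross matrix is skew and its square symmetric, while sine is odd and cosine
  even.\<close>

lemma transpose_rodrigues: "transpose (rodrigues u t) = rodrigues u (- t)"
  by (simp add: rodrigues_def cross_matrix_def vec_eq_iff forall_3 transpose_def mat_def
      matrix_matrix_mult_def sum_3)

text \<open>The determinant is nonnegative because a rotation is the square of the rotation by half the
  angle.\<close>

lemma rodrigues_special:
  assumes "norm u = 1"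
  shows "rodrigues u t \<in> special_isometries (mat 1)"
proof -
  have 1: "transpose (rodrigues u t) ** rodrigues u t = mat 1"
    using rodrigues_add[OF assms, of "- t" t] by (simp add: transpose_rodrigues)
  have "det (rodrigues u t) = det (rodrigues u (t/2)) ^ 2"
    using rodrigues_add[OF assms, of "t/2" "t/2"]
    by (simp add: power2_eq_square flip: det_mul)
  then have "det (rodrigues u t) \<ge> 0"
    by simp
  moreover have "(det (rodrigues u t))\<^sup>2 = 1"
    using arg_cong[OF 1, of det] by (simp add: det_mul power2_eq_square)
  ultimately show ?thesis
    using 1 by (auto simp: special_isometries_def power2_eq_1_iff)
qed

text \<open>R^T (R - 1) = (1 - R)^T, and in odd dimension det (1 - R) = - det (R - 1). Hence det (R
  - 1) = 0, and R - 1 has a nonzero kernel vector.\<close>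

lemma rotation_axis:
  fixes R :: "real^3^3"
  assumes "R \<in> special_isometries (mat 1)"
  obtains u where "norm u = 1" "R *v u = u"
proof -
  have R: "transpose R ** R = mat 1" "det R = 1"
    using assms by (auto simp: special_isometries_def)
  have "det (R - mat 1) = det (transpose R) * det (R - mat 1)"
    using R by simp
  also have "\<dots> = det (transpose R ** (R - mat 1))"
    by (simp add: det_mul)
  also have "transpose R ** (R - mat 1) = transpose (mat 1 - R)"
  proof -
    have "transpose (mat 1 - R) = mat 1 - transpose R"
      by (auto simp: vec_eq_iff transpose_def mat_def)
    then show ?thesis
      by (simp add: R matrix_eq matrix_vector_mult_diff_rdistrib matrix_vector_mult_diff_distrib
          matrix_vector_mul_assoc del: transpose_matrix_vector flip: matrix_vector_mul_assoc[of _ "R - mat 1"])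
  qed
  also have "det (transpose (mat 1 - R)) = - det (R - mat 1)"
    by (subst det_transpose) (simp add: det_3 algebra_simps)
  finally have "det (R - mat 1) = 0"
    by simp
  then have "\<not> inj ((*v) (R - mat 1))"
    by (metis inj_matrix_vector_mult invertible_det_nz matrix_left_invertible_injective invertible_left_inverse)
  then obtain x y where "(R - mat 1) *v x = (R - mat 1) *v y" "x \<noteq> y"
    by (auto simp: inj_def)
  then have "R *v (x - y) = x - y" "x - y \<noteq> 0"
    by (auto simp: matrix_vector_mult_diff_rdistrib matrix_vector_mult_diff_distrib algebra_simps)
  then show ?thesis
    by (intro that[of "(1 / norm (x - y)) *\<^sub>R (x - y)"]) (simp_all add: matrix_vector_mult_scaleR)
qed

text \<open>In an orthonormal frame u, e, f = u x e with \<open>u\<close> on the axis, R e is a unit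
  vector orthogonal to \<open>u\<close>, which defines the angle. As R preserves cross products, R f
  = u x R e is then determined, and both maps agree on the frame.\<close>

lemma rotation_is_rodrigues:
  fixes R :: "real^3^3"
  assumes R: "R \<in> special_isometries (mat 1)"
  obtains u t where "norm u = 1" "R = rodrigues u t"
proof -
  obtain u where u: "norm u = 1" "R *v u = u"
    using rotation_axis[OF R] .
  have orth: "orthogonal_matrix R" and "rotation_matrix R"
    using R by (auto simp: special_isometries_def orthogonal_matrix rotation_matrix_def)
  then have R_cross: "R *v cross3 x y = cross3 (R *v x) (R *v y)" for x y
    by (simp add: cross_rotation_matrix)
  have R_dot: "(R *v x) \<bullet> (R *v y) = x \<bullet> y" for x y
    using orth orthogonal_transformation_matrix[of "(*v) R"] by (simp add: orthogonal_transformation_def)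
  obtain e0 :: "real^3" where "e0 \<noteq> 0" "orthogonal u e0"
    using orthogonal_to_vector_exists[of u] by auto
  define e where "e = (1 / norm e0) *\<^sub>R e0"
  have e: "e \<bullet> e = 1" "u \<bullet> e = 0" "e \<bullet> u = 0"
    using \<open>e0 \<noteq> 0\<close> \<open>orthogonal u e0\<close> by (auto simp: e_def orthogonal_def dot_square_norm power2_eq_square inner_commute)
  define f where "f = cross3 u e"
  have uu: "u \<bullet> u = 1"
    using u by (simp add: dot_square_norm)
  have uf: "cross3 u f = - e" and ef: "cross3 e f = u"
    using e uu by (simp_all add: f_def Lagrange)
  \<comment> \<open>The expansion is read off from two triple products, u x (u x x) and x x (e x f),
    the latter being x x u.\<close>
  have expand: "x = (x \<bullet> u) *\<^sub>R u + (x \<bullet> e) *\<^sub>R e + (x \<bullet> f) *\<^sub>R f" for x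
  proof -
    have "x = (x \<bullet> u) *\<^sub>R u - cross3 u (cross3 u x)"
      using uu by (simp add: Lagrange inner_commute)
    moreover have "cross3 x u = (x \<bullet> f) *\<^sub>R e - (x \<bullet> e) *\<^sub>R f"
      by (simp add: ef[symmetric] Lagrange)
    then have "cross3 u x = (x \<bullet> e) *\<^sub>R f - (x \<bullet> f) *\<^sub>R e"
      by (metis cross_skew minus_diff_eq)
    then have "cross3 u (cross3 u x) = - (x \<bullet> e) *\<^sub>R e - (x \<bullet> f) *\<^sub>R f"
      by (simp add: Cross3.right_diff_distrib cross_mult_right uf f_def[symmetric])
    ultimately show ?thesis
      by (simp add: algebra_simps)
  qed
  have fe: "f \<bullet> e = 0" "f \<bullet> f = 1"
    using norm_cross_dot[of u e] e u uu by (simp_all add: f_def dot_cross_self dot_square_norm)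
  have "(R *v e) \<bullet> u = 0"
    using R_dot[of e u] u e by simp
  then have Re: "R *v e = ((R *v e) \<bullet> e) *\<^sub>R e + ((R *v e) \<bullet> f) *\<^sub>R f"
    using expand[of "R *v e"] by simp
  have "1 = (R *v e) \<bullet> (R *v e)"
    using R_dot e by simp
  also have "\<dots> = ((R *v e) \<bullet> e)\<^sup>2 + ((R *v e) \<bullet> f)\<^sup>2"
    by (subst (2) Re) (simp add: inner_add_right power2_eq_square)
  finally obtain t where t: "(R *v e) \<bullet> e = cos t" "(R *v e) \<bullet> f = sin t"
    by (metis sincos_total_2pi)
  have Re: "R *v e = cos t *\<^sub>R e + sin t *\<^sub>R f"
    using Re t by simp
  have Rf: "R *v f = cos t *\<^sub>R f - sin t *\<^sub>R e"
    unfolding f_def R_cross u Re by (simp add: cross_add_right cross_mult_right uf f_def[symmetric])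
  have rod: "rodrigues u t *v u = u" "rodrigues u t *v e = cos t *\<^sub>R e + sin t *\<^sub>R f"
    "rodrigues u t *v f = cos t *\<^sub>R f - sin t *\<^sub>R e"
    by (simp_all add: rodrigues_mult uf f_def[symmetric] algebra_simps)
  have "R *v x = rodrigues u t *v x" for x
    by (subst (1 2) expand)
      (simp add: matrix_vector_right_distrib matrix_vector_mult_scaleR u Re Rf rod)
  then have "R = rodrigues u t"
    by (simp add: matrix_eq)
  with u show ?thesis
    using that by blast
qed

section \<open>The subgroups of the Iwasawa decomposition\<close>

lemma vector_4 [simp]:
  "(vector [x, y, z, w] :: 'a::zero^4) $ 1 = x" "(vector [x, y, z, w] :: 'a^4) $ 2 = y"
  "(vector [x, y, z, w] :: 'a^4) $ 3 = z" "(vector [x, y, z, w] :: 'a^4) $ 4 = w"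
  by (simp_all add: vector_def)

lemma det_4:
  fixes A :: "'a::comm_ring_1^4^4"
  shows "det A =
    A$1$1 * (A$2$2 * (A$3$3 * A$4$4 - A$3$4 * A$4$3) - A$2$3 * (A$3$2 * A$4$4 - A$3$4 * A$4$2)
           + A$2$4 * (A$3$2 * A$4$3 - A$3$3 * A$4$2))
  - A$1$2 * (A$2$1 * (A$3$3 * A$4$4 - A$3$4 * A$4$3) - A$2$3 * (A$3$1 * A$4$4 - A$3$4 * A$4$1)
           + A$2$4 * (A$3$1 * A$4$3 - A$3$3 * A$4$1))
  + A$1$3 * (A$2$1 * (A$3$2 * A$4$4 - A$3$4 * A$4$2) - A$2$2 * (A$3$1 * A$4$4 - A$3$4 * A$4$1)
           + A$2$4 * (A$3$1 * A$4$2 - A$3$2 * A$4$1))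
  - A$1$4 * (A$2$1 * (A$3$2 * A$4$3 - A$3$3 * A$4$2) - A$2$2 * (A$3$1 * A$4$3 - A$3$3 * A$4$1)
           + A$2$3 * (A$3$1 * A$4$2 - A$3$2 * A$4$1))"
proof -
  have f: "finite {2::4, 3, 4}" "1 \<notin> {2::4, 3, 4}" "finite {3::4, 4}" "2 \<notin> {3::4, 4}"
    "finite {4::4}" "3 \<notin> {4::4}"
    by auto
  show ?thesis
    \<comment> \<open>Permutations are split by the image of 1, the remaining ones by the image of
      2, and then by that of 3.\<close>
    unfolding det_def UNIV_4 sum_over_permutations_insert[OF f(1,2)]
      sum_over_permutations_insert[OF f(3,4)] sum_over_permutations_insert[OF f(5,6)] permutes_sing
    by (simp add: sign_swap_id permutation_swap_id permutation_compose sign_compose sign_id swap_id_eq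
        algebra_simps)
qed

text \<open>The corner \<open>s\<close> is 1 for rotations of space, 0 for their generators and -1
  for \<open>eta31\<close>.\<close>

definition block :: "real \<Rightarrow> real^3^3 \<Rightarrow> real^4^4" where
  "block s W = vector [vector [s, 0, 0, 0],
                       vector [0, W$1$1, W$1$2, W$1$3],
                       vector [0, W$2$1, W$2$2, W$2$3],
                       vector [0, W$3$1, W$3$2, W$3$3]]"

definition boost :: "real \<Rightarrow> real^4^4" where
  "boost t = vector [vector [cosh t, sinh t, 0, 0],
                     vector [sinh t, cosh t, 0, 0],
                     vector [0, 0, 1, 0],
                     vector [0, 0, 0, 1]]"

text \<open>The exponential of the generator of \<open>Lorentz_N\<close> with parameters a, b;
  \<open>r\<close> comes from half its square. These matrices fix the null vector (1, 1, 0,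
  0).\<close>

definition null_rotation :: "real \<Rightarrow> real \<Rightarrow> real^4^4" where
  "null_rotation a b = (let r = (a\<^sup>2 + b\<^sup>2) / 2 in
     vector [vector [1 + r, - r, a, b],
             vector [r, 1 - r, a, b],
             vector [a, - a, 1, 0],
             vector [b, - b, 0, 1]])"

lemmas matrix_entries = vec_eq_iff forall_4 forall_3 matrix_matrix_mult_def sum_4 sum_3

lemma block_mult: "block s V ** block t W = block (s * t) (V ** W)"
  by (simp add: block_def matrix_entries)

lemma block_add: "block s V + block t W = block (s + t) (V + W)"
  by (simp add: block_def matrix_entries)

lemma block_scaleR: "c *\<^sub>R block s W = block (c * s) (c *\<^sub>R W)"
  by (simp add: block_def matrix_entries)

lemma block_mat_1: "block 1 (mat 1) = mat 1"
  by (simp add: block_def matrix_entries mat_def)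

lemma eta31_block: "eta31 = block (- 1) (mat 1)"
  by (simp add: eta31_def block_def matrix_entries mat_def)

lemma transpose_block: "transpose (block s W) = block s (transpose W)"
  by (simp add: block_def matrix_entries transpose_def)

lemma det_block: "det (block s W) = s * det W"
  by (simp add: block_def det_4 det_3 algebra_simps)

lemma block_eq_iff: "block s V = block t W \<longleftrightarrow> s = t \<and> V = W"
  by (auto simp: block_def matrix_entries)

lemma block_special_iff:
  "block 1 R \<in> special_isometries eta31 \<longleftrightarrow> R \<in> special_isometries (mat 1)"
  by (simp add: special_isometries_def eta31_block transpose_block block_mult det_block block_eq_iff)

lemma eta31_square: "eta31 ** eta31 = mat 1"
  by (simp add: eta31_block block_mult block_mat_1)

lemma boost_0 [simp]: "boost 0 = mat 1"
  by (simp add: boost_def matrix_entries mat_def)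

lemma null_rotation_0 [simp]: "null_rotation 0 0 = mat 1"
  by (simp add: null_rotation_def matrix_entries mat_def)

lemma boost_add: "boost s ** boost t = boost (s + t)"
  by (simp add: boost_def matrix_entries cosh_add sinh_add algebra_simps)

lemma null_rotation_add:
  "null_rotation a b ** null_rotation c d = null_rotation (a + c) (b + d)"
  by (simp add: null_rotation_def Let_def matrix_entries power2_eq_square field_simps)

text \<open>Boosts normalize the null rotations and rescale their parameters; this is what makes
  \<open>Lorentz_AN\<close> a group.\<close>

lemma null_rotation_boost:
  "null_rotation a b ** boost t = boost t ** null_rotation (exp (- t) * a) (exp (- t) * b)"
proof -
  \<comment> \<open>In terms of \<open>u\<close> the hyperbolic functions are rational, and the
    claim becomes an identity of fractions.\<close>
  define u where "u = exp t"
  have u: "cosh t = (u + 1 / u) / 2" "sinh t = (u - 1 / u) / 2" "exp (- t) = 1 / u" "u \<noteq> 0"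
    by (simp_all add: u_def cosh_field_def sinh_field_def exp_minus field_simps)
  show ?thesis
    unfolding null_rotation_def Let_def boost_def u(1-3)
    using u(4) by (simp add: matrix_entries power2_eq_square field_simps)
qed

lemma boost_special: "boost t \<in> special_isometries eta31"
proof -
  have "cosh t * cosh t = 1 + sinh t * sinh t"
    using cosh_square_eq[of t] by (simp add: power2_eq_square)
  then show ?thesis
    by (simp add: special_isometries_def boost_def eta31_def matrix_entries transpose_def det_4 mat_def
        algebra_simps)
qed

lemma null_rotation_special: "null_rotation a b \<in> special_isometries eta31"
  by (simp add: special_isometries_def null_rotation_def Let_def eta31_def matrix_entries
      transpose_def det_4 mat_def power2_eq_square field_simps)

lemma Lorentz_K_eq: "Lorentz_K = block 1 ` special_isometries (mat 1)"
proof -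
  have mexp_block: "mexp (block 0 (t *\<^sub>R cross_matrix u)) = block 1 (rodrigues u t)"
    if "norm u = 1" for u t
  proof -
    have "block 0 (cross_matrix u) ** (block 0 (cross_matrix u) ** block 0 (cross_matrix u))
        = - block 0 (cross_matrix u)"
      using cross_matrix_cubed[OF that] block_scaleR[of "-1" 0 "cross_matrix u"]
      by (simp add: block_mult)
    then have "mexp (t *\<^sub>R block 0 (cross_matrix u)) = block 1 (rodrigues u t)"
      by (subst mexp_rotation)
        (simp_all add: rodrigues_def block_mult block_scaleR block_add flip: block_mat_1)
    then show ?thesis
      by (simp add: block_scaleR)
  qed
  \<comment> \<open>Comparing entries with \<open>cross_matrix\<close> gives the axis: a = - u3, b =
    u2, c = - u1.\<close>
  have gen: "vector [vector [0, 0, 0, 0], vector [0, 0, a, b], vector [0, - a, 0, c], vector [0, - b, - c, 0]]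
      = block 0 (cross_matrix (vector [- c, b, - a]))" for a b c
    by (simp add: block_def cross_matrix_def)
  have scale: "cross_matrix (t *\<^sub>R u) = t *\<^sub>R cross_matrix u" for t u
    by (simp add: cross_matrix_def vec_eq_iff forall_3)
  show ?thesis
  proof (intro equalityI subsetI)
    fix M assume "M \<in> Lorentz_K"
    then obtain a b c where M: "M = mexp (block 0 (cross_matrix (vector [- c, b, - a])))"
      by (auto simp: Lorentz_K_def gen)
    define v :: "real^3" where "v = vector [- c, b, - a]"
    \<comment> \<open>For the zero generator any unit vector serves as axis, with angle 0.\<close>
    obtain u where u: "norm u = 1" "v = norm v *\<^sub>R u"
    proof (cases "v = 0")
      case True
      then show ?thesis
        using that[of "axis 1 1"] by simp
    next
      case False
      then show ?thesis
        using that[of "(1 / norm v) *\<^sub>R v"] by simp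
    qed
    have "M = block 1 (rodrigues u (norm v))"
      unfolding M v_def[symmetric] using mexp_block[OF u(1), of "norm v"] u(2) by (simp flip: scale)
    then show "M \<in> block 1 ` special_isometries (mat 1)"
      using rodrigues_special[OF u(1)] by auto
  next
    fix M assume "M \<in> block 1 ` special_isometries (mat 1)"
    then obtain R where R: "M = block 1 R" "R \<in> special_isometries (mat 1)"
      by auto
    obtain u t where u: "norm u = 1" "R = rodrigues u t"
      using rotation_is_rodrigues[OF R(2)] .
    have "vector [(t *\<^sub>R u) $ 1, (t *\<^sub>R u) $ 2, (t *\<^sub>R u) $ 3] = t *\<^sub>R u"
      by (simp add: vec_eq_iff forall_3)
    \<comment> \<open>The double negations match the pattern of \<open>gen\<close> with a = - t u3
      and c = - t u1.\<close>
    then have "M = mexp (block 0 (cross_matrix (vector [- (- (t * u $ 1)), t * u $ 2, - (- (t * u $ 3))])))"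
      using R u mexp_block[OF u(1), of t] by (simp add: scale)
    then show "M \<in> Lorentz_K"
      unfolding Lorentz_K_def gen by blast
  qed
qed

lemma Lorentz_A_eq: "Lorentz_A = range boost"
proof -
  define Y :: "real^4^4" where
    "Y = vector [vector [0, 1, 0, 0], vector [1, 0, 0, 0], vector [0, 0, 0, 0], vector [0, 0, 0, 0]]"
  have "vector [vector [0, t, 0, 0], vector [t, 0, 0, 0], vector [0, 0, 0, 0], vector [0, 0, 0, 0]]
      = t *\<^sub>R Y" for t
    by (simp add: Y_def matrix_entries)
  moreover have "mexp (t *\<^sub>R Y) = boost t" for t
  proof -
    have "Y ** (Y ** Y) = Y"
      by (simp add: Y_def matrix_entries)
    then show ?thesis
      by (simp add: mexp_boost) (simp add: Y_def boost_def matrix_entries mat_def)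
  qed
  ultimately show ?thesis
    by (auto simp: Lorentz_A_def)
qed

lemma Lorentz_N_eq: "Lorentz_N = {null_rotation a b | a b. True}"
proof -
  have "mexp (vector [vector [0, 0, a, b], vector [0, 0, a, b], vector [a, - a, 0, 0],
      vector [b, - b, 0, 0]]) = null_rotation a b" (is "mexp ?Y = _") for a b
  proof -
    have "?Y ** (?Y ** ?Y) = 0"
      by (simp add: matrix_entries)
    then show ?thesis
      by (simp add: mexp_nilpotent)
        (simp add: null_rotation_def Let_def matrix_entries mat_def power2_eq_square field_simps)
  qed
  then show ?thesis
    by (auto simp: Lorentz_N_def)
qed

section \<open>One-parameter curves and membership in the identity component\<close>

lemma continuous_on_vector_4 [continuous_intros]:
  fixes a b c d :: "'a::topological_space \<Rightarrow> 'b::{zero,topological_space}"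
  assumes "continuous_on S a" "continuous_on S b" "continuous_on S c" "continuous_on S d"
  shows "continuous_on S (\<lambda>x. vector [a x, b x, c x, d x] :: 'b^4)"
proof -
  have "continuous_on S (\<lambda>x. (vector [a x, b x, c x, d x] :: 'b^4) $ i)" for i
    using exhaust_4[of i] assms by auto
  then have "continuous_on S (\<lambda>x. \<chi> i. (vector [a x, b x, c x, d x] :: 'b^4) $ i)"
    by (intro continuous_on_vec_lambda)
  then show ?thesis by simp
qed

lemma Lorentz_K_subset: "Lorentz_K \<subseteq> carrier Lorentz"
proof -
  have "block 1 R \<in> carrier Lorentz" if R: "R \<in> special_isometries (mat 1)" for R
  proof -
    obtain u t where u: "norm u = 1" "R = rodrigues u t"
      using rotation_is_rodrigues[OF R] .
    have "block 1 (rodrigues u t) \<in> identity_component (special_isometries eta31)"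
    proof (rule identity_component_path[of "\<lambda>t. block 1 (rodrigues u t)" _ 0])
      show "continuous_on UNIV (\<lambda>t. block 1 (rodrigues u t))"
        unfolding block_def rodrigues_def by (intro continuous_intros)
    qed (use rodrigues_special[OF u(1)] in \<open>auto simp: block_special_iff block_mat_1\<close>)
    then show ?thesis
      by (simp add: u Lorentz_def matrix_group_def)
  qed
  then show ?thesis
    by (auto simp: Lorentz_K_eq)
qed

lemma Lorentz_A_subset: "Lorentz_A \<subseteq> carrier Lorentz"
proof -
  have "boost t \<in> identity_component (special_isometries eta31)" for t
  proof (rule identity_component_path[of _ _ 0])
    show "continuous_on UNIV boost"
      unfolding boost_def by (intro continuous_intros)
  qed (auto simp: boost_special)
  then show ?thesis
    by (auto simp: Lorentz_A_eq Lorentz_def matrix_group_def)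
qed

lemma Lorentz_N_subset: "Lorentz_N \<subseteq> carrier Lorentz"
proof -
  have "null_rotation (t * a) (t * b) \<in> identity_component (special_isometries eta31)" for a b t
  proof (rule identity_component_path[of "\<lambda>t. null_rotation (t * a) (t * b)" _ 0])
    show "continuous_on UNIV (\<lambda>t. null_rotation (t * a) (t * b))"
      unfolding null_rotation_def Let_def by (intro continuous_intros) auto
  qed (auto simp: null_rotation_special)
  from this[of 1] show ?thesis
    by (auto simp: Lorentz_N_eq Lorentz_def matrix_group_def)
qed

section \<open>Existence and uniqueness of the Iwasawa factors\<close>

lemma isometry_row_1:
  assumes "M \<in> special_isometries eta31"
  shows "(M$1$1)\<^sup>2 = 1 + (M$1$2)\<^sup>2 + (M$1$3)\<^sup>2 + (M$1$4)\<^sup>2"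
proof -
  \<comment> \<open>The defining relation concerns columns; the right inverse yields the
    corresponding relation for rows.\<close>
  have "M ** (eta31 ** transpose M ** eta31) = mat 1"
    using isometry_inverse(2)[OF eta31_square] assms by (simp add: special_isometries_def)
  then have "(M ** (eta31 ** transpose M ** eta31)) $ 1 $ 1 = 1"
    by (simp add: mat_def)
  then show ?thesis
    by (simp add: eta31_def matrix_entries transpose_def power2_eq_square algebra_simps)
qed

lemma Lorentz_time_entry_pos:
  assumes "M \<in> carrier Lorentz"
  shows "M$1$1 > 0"
proof -
  have "y$1$1 \<noteq> 0" if "y \<in> special_isometries eta31" for y
    using isometry_row_1[OF that]
    by (metis (no_types) add_nonneg_nonneg add_pos_nonneg less_numeral_extra(1,3) zero_le_power2 zero_power2)
  then show ?thesis
    using assms identity_component_pos[of M "special_isometries eta31" 1]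
    by (auto simp: Lorentz_def matrix_group_def)
qed

text \<open>When the first row is the first unit vector, the first column of M (eta M^T eta) is that
  of M itself. The product is the identity, so M is block diagonal.\<close>

lemma isometry_fixing_time:
  assumes "M \<in> special_isometries eta31" "M $ 1 = axis 1 1"
  obtains R where "R \<in> special_isometries (mat 1)" "M = block 1 R"
proof -
  have "M ** (eta31 ** transpose M ** eta31) = mat 1"
    using isometry_inverse(2)[OF eta31_square] assms by (simp add: special_isometries_def)
  then have "(M ** (eta31 ** transpose M ** eta31)) $ i $ 1 = (mat 1 :: real^4^4) $ i $ 1" for i
    by simp
  moreover have row: "M$1$1 = 1" "M$1$2 = 0" "M$1$3 = 0" "M$1$4 = 0"
    using assms(2) by (simp_all add: axis_def)
  ultimately have col: "M$2$1 = 0" "M$3$1 = 0" "M$4$1 = 0"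
    by (simp_all add: eta31_def matrix_entries transpose_def mat_def)
  define R :: "real^3^3" where
    "R = vector [vector [M$2$2, M$2$3, M$2$4], vector [M$3$2, M$3$3, M$3$4], vector [M$4$2, M$4$3, M$4$4]]"
  have "M = block 1 R"
    by (simp add: R_def block_def matrix_entries row col)
  then show ?thesis
    using that assms(1) block_special_iff by blast
qed

text \<open>The first two entries add up to exp t, and the last two then yield a and b.\<close>

lemma boost_null_rotation_row_1:
  "(boost t ** null_rotation a b) $ 1 =
     vector [cosh t + exp t * (a\<^sup>2 + b\<^sup>2) / 2, sinh t - exp t * (a\<^sup>2 + b\<^sup>2) / 2, exp t * a, exp t * b]"
  by (simp add: boost_def null_rotation_def Let_def matrix_entries field_simps
      flip: cosh_plus_sinh)

lemma Iwasawa_decomposition: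
  assumes "M \<in> carrier Lorentz"
  obtains R t a b where "R \<in> special_isometries (mat 1)"
    "M = block 1 R ** (boost t ** null_rotation a b)"
proof -
  define p q y z where pq: "p = M$1$1" "q = M$1$2" "y = M$1$3" "z = M$1$4"
  have M: "M \<in> special_isometries eta31"
    using assms identity_component_subset by (auto simp: Lorentz_def matrix_group_def)
  have p: "p\<^sup>2 = 1 + q\<^sup>2 + y\<^sup>2 + z\<^sup>2" "p > 0"
    using isometry_row_1[OF M] Lorentz_time_entry_pos[OF assms] by (simp_all add: pq)
  \<comment> \<open>Here the positive time entry is decisive: the row relation alone bounds q only
    by the absolute value of p.\<close>
  have "\<bar>q\<bar> < p"
    using p by (intro power2_less_imp_less[of _ p]) (auto intro: add_pos_nonneg simp: add.assoc)
  then have s: "p + q > 0"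
    by linarith
  define t a b where tab: "t = ln (p + q)" "a = y / (p + q)" "b = z / (p + q)"
  have et: "exp t = p + q"
    using s by (simp add: tab)
  have "(p + q) * (p - q) = 1 + y\<^sup>2 + z\<^sup>2"
    using p by (simp add: power2_eq_square algebra_simps)
  then have "p - q = (1 + y\<^sup>2 + z\<^sup>2) / (p + q)"
    using s by (simp add: nonzero_eq_divide_eq mult.commute)
  moreover have "r * ((y / r)\<^sup>2 + (z / r)\<^sup>2) = (y\<^sup>2 + z\<^sup>2) / r" if "r > 0" for r
    using that by (simp add: power2_eq_square field_simps)
  ultimately have "p - q = 1 / (p + q) + (p + q) * (a\<^sup>2 + b\<^sup>2)"
    using s by (simp add: tab add_divide_distrib)
  moreover have "cosh t = ((p + q) + 1 / (p + q)) / 2" "sinh t = ((p + q) - 1 / (p + q)) / 2"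
    by (simp_all add: cosh_field_def sinh_field_def exp_minus et inverse_eq_divide)
  \<comment> \<open>The entries are recovered from the sum p + q and the difference p - q. Here
    \<open>e\<close> stands for 1 / (p + q) and \<open>D\<close> for exp t (a^2 + b^2).\<close>
  moreover have "C + D / 2 = p \<and> S - D / 2 = q"
    if "p - q = e + D" "C = (p + q + e) / 2" "S = (p + q - e) / 2" for C S D e
    using that by (simp add: field_simps)
  ultimately have "cosh t + exp t * (a\<^sup>2 + b\<^sup>2) / 2 = p \<and> sinh t - exp t * (a\<^sup>2 + b\<^sup>2) / 2 = q"
    unfolding et by blast
  moreover have "exp t * a = y" "exp t * b = z"
    unfolding et using s by (simp_all add: tab)
  ultimately have row: "(boost t ** null_rotation a b) $ 1 = M $ 1"
    unfolding boost_null_rotation_row_1 by (simp add: vec_eq_iff forall_4 pq)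
  define C where "C = M ** (null_rotation (- a) (- b) ** boost (- t))"
  have inv1: "boost t ** null_rotation a b ** (null_rotation (- a) (- b) ** boost (- t)) = mat 1"
    by (metis (no_types) add.right_inverse boost_0 boost_add matrix_mul_assoc matrix_mul_rid
        null_rotation_0 null_rotation_add)
  then have inv2: "(null_rotation (- a) (- b) ** boost (- t)) ** (boost t ** null_rotation a b) = mat 1"
    by (rule matrix_left_right_inverse[THEN iffD1])
  have "C \<in> special_isometries eta31"
    unfolding C_def by (intro special_isometries_mult M boost_special null_rotation_special)
  \<comment> \<open>The first row of a product depends only on the first row of its left factor, so
    M may be replaced by the matching element of \<open>Lorentz_AN\<close>.\<close>
  moreover have "C $ 1 = (boost t ** null_rotation a b ** (null_rotation (- a) (- b) ** boost (- t))) $ 1"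
    unfolding C_def matrix_matrix_mult_def[of M] matrix_matrix_mult_def[of "boost t ** null_rotation a b"]
    by (simp add: row)
  then have "C $ 1 = axis 1 1"
    unfolding inv1 by (auto simp: mat_def axis_def vec_eq_iff)
  ultimately obtain R where R: "R \<in> special_isometries (mat 1)" "C = block 1 R"
    using isometry_fixing_time by blast
  have "M = C ** (boost t ** null_rotation a b)"
    unfolding C_def matrix_mul_assoc[symmetric, of M] inv2 by simp
  with R show ?thesis
    using that by blast
qed

text \<open>The first row of the block matrix is the first unit vector, which forces a = b = 0 and
  exp t = cosh t + sinh t = 1.\<close>

lemma block_eq_boost_null_rotation:
  assumes "block 1 R = boost t ** null_rotation a b"
  shows "boost t ** null_rotation a b = mat 1"
proof -
  have "block 1 R $ 1 = axis 1 1"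
    by (simp add: block_def vec_eq_iff forall_4 axis_def)
  then have "(boost t ** null_rotation a b) $ 1 = axis 1 1"
    using assms by simp
  then have ab: "a = 0" "b = 0" and "cosh t = 1" "sinh t = 0"
    unfolding boost_null_rotation_row_1 by (auto simp: vec_eq_iff forall_4 axis_def)
  then have "exp t = 1"
    by (simp flip: cosh_plus_sinh)
  then show ?thesis
    using ab by simp
qed

section \<open>The Poincare group\<close>

text \<open>An explicit left inverse inside the set stands in for a computation of
  \<open>inv\<close> in a matrix group.\<close>

lemma (in group) subgroupI_left_inverse:
  assumes "S \<subseteq> carrier G" "\<one> \<in> S" "\<And>x y. x \<in> S \<Longrightarrow> y \<in> S \<Longrightarrow> x \<otimes> y \<in> S"
    and "\<And>x. x \<in> S \<Longrightarrow> \<exists>y\<in>S. y \<otimes> x = \<one>"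
  shows "subgroup S G"
proof (rule subgroupI)
  fix x assume "x \<in> S"
  then obtain y where "y \<in> S" "y \<otimes> x = \<one>"
    using assms(4) by blast
  then show "inv x \<in> S"
    using \<open>x \<in> S\<close> assms(1) inv_equality[of y x] by auto
qed (use assms in auto)

section \<open>The subgroups of the Lorentz group and its factorization\<close>

lemma Lorentz_simps [simp]: "x \<otimes>\<^bsub>Lorentz\<^esub> y = x ** y" "\<one>\<^bsub>Lorentz\<^esub> = mat 1"
  by (simp_all add: Lorentz_def matrix_group_def)

interpretation Lorentz: group Lorentz
  unfolding Lorentz_def by (rule group_identity_component[OF eta31_square])

lemma mat_1_Lorentz [simp]: "mat 1 \<in> carrier Lorentz"
  using Lorentz.one_closed by simp

lemma Lorentz_AN_eq: "Lorentz_AN = {boost t ** null_rotation a b | t a b. True}"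
  by (auto simp: Lorentz_AN_def set_mult_def Lorentz_A_eq Lorentz_N_eq)

lemma subgroup_K: "subgroup Lorentz_K Lorentz"
proof (rule Lorentz.subgroupI_left_inverse)
  fix x assume "x \<in> Lorentz_K"
  then obtain R where R: "x = block 1 R" "R \<in> special_isometries (mat 1)"
    by (auto simp: Lorentz_K_eq)
  then have "transpose R \<in> special_isometries (mat 1)"
    using special_isometries_inverse[of "mat 1" R] by simp
  moreover have "transpose R ** R = mat 1"
    using R by (simp add: special_isometries_def)
  ultimately show "\<exists>y\<in>Lorentz_K. y \<otimes>\<^bsub>Lorentz\<^esub> x = \<one>\<^bsub>Lorentz\<^esub>"
    using R by (auto simp: Lorentz_K_eq block_mult block_mat_1 intro!: bexI[of _ "transpose R"])
qed (auto simp: Lorentz_K_eq block_mult special_isometries_mult Lorentz_K_subset[unfolded Lorentz_K_eq]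
    simp flip: block_mat_1)

lemma subgroup_A: "subgroup Lorentz_A Lorentz"
proof (rule Lorentz.subgroupI_left_inverse)
  fix x assume "x \<in> Lorentz_A"
  then obtain t where "x = boost t"
    by (auto simp: Lorentz_A_eq)
  then show "\<exists>y\<in>Lorentz_A. y \<otimes>\<^bsub>Lorentz\<^esub> x = \<one>\<^bsub>Lorentz\<^esub>"
    by (intro bexI[of _ "boost (- t)"]) (auto simp: Lorentz_A_eq boost_add)
qed (use Lorentz_A_subset in \<open>auto simp: Lorentz_A_eq boost_add simp flip: boost_0\<close>)

lemma subgroup_N: "subgroup Lorentz_N Lorentz"
proof (rule Lorentz.subgroupI_left_inverse)
  fix x assume "x \<in> Lorentz_N"
  then obtain a b where "x = null_rotation a b"
    by (auto simp: Lorentz_N_eq)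
  then show "\<exists>y\<in>Lorentz_N. y \<otimes>\<^bsub>Lorentz\<^esub> x = \<one>\<^bsub>Lorentz\<^esub>"
    by (intro bexI[of _ "null_rotation (- a) (- b)"]) (auto simp: Lorentz_N_eq null_rotation_add)
next
  show "\<one>\<^bsub>Lorentz\<^esub> \<in> Lorentz_N"
    by (auto simp: Lorentz_N_eq simp flip: null_rotation_0)
next
  fix x y assume "x \<in> Lorentz_N" "y \<in> Lorentz_N"
  then show "x \<otimes>\<^bsub>Lorentz\<^esub> y \<in> Lorentz_N"
    by (auto simp: Lorentz_N_eq null_rotation_add) blast
qed (rule Lorentz_N_subset)

lemma subgroup_AN: "subgroup Lorentz_AN Lorentz"
proof (rule Lorentz.subgroupI_left_inverse)
  show "Lorentz_AN \<subseteq> carrier Lorentz"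
    unfolding Lorentz_AN_def
    by (intro Lorentz.setmult_subset_G Lorentz_A_subset Lorentz_N_subset)
  have *: "boost t ** null_rotation a b \<in> Lorentz_AN" for t a b
    by (auto simp: Lorentz_AN_eq)
  show "\<one>\<^bsub>Lorentz\<^esub> \<in> Lorentz_AN"
    using *[of 0 0 0] by simp
  have mult: "boost t ** null_rotation a b ** (boost s ** null_rotation c d) =
      boost (t + s) ** null_rotation (exp (- s) * a + c) (exp (- s) * b + d)" for t a b s c d
  proof -
    have "boost t ** null_rotation a b ** (boost s ** null_rotation c d)
        = boost t ** (null_rotation a b ** boost s) ** null_rotation c d"
      by (simp only: matrix_mul_assoc)
    also have "\<dots> = (boost t ** boost s) **
        (null_rotation (exp (- s) * a) (exp (- s) * b) ** null_rotation c d)"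
      by (simp only: null_rotation_boost matrix_mul_assoc)
    finally show ?thesis
      by (simp only: boost_add null_rotation_add)
  qed
  show "x \<otimes>\<^bsub>Lorentz\<^esub> y \<in> Lorentz_AN" if "x \<in> Lorentz_AN" "y \<in> Lorentz_AN" for x y
    using that by (auto simp: Lorentz_AN_eq mult) blast
  show "\<exists>y\<in>Lorentz_AN. y \<otimes>\<^bsub>Lorentz\<^esub> x = \<one>\<^bsub>Lorentz\<^esub>" if x: "x \<in> Lorentz_AN" for x
  proof -
    obtain t a b where "x = boost t ** null_rotation a b"
      using x by (auto simp: Lorentz_AN_eq)
    \<comment> \<open>The parameters of the inverse solve exp (- t) a' + a = 0 and exp (- t) b' + b
      = 0.\<close>
    then show ?thesis
      using mult[of "- t" "- exp t * a" "- exp t * b" t a b]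
      by (intro bexI[OF _ *[of "- t" "- exp t * a" "- exp t * b"]]) (simp add: exp_minus field_simps)
  qed
qed

lemma K_Int_AN: "Lorentz_K \<inter> Lorentz_AN = {mat 1}"
  using subgroup.one_closed[OF subgroup_K] subgroup.one_closed[OF subgroup_AN]
    block_eq_boost_null_rotation
  by (auto simp: Lorentz_K_eq Lorentz_AN_eq)

lemma A_Int_N: "Lorentz_A \<inter> Lorentz_N = {mat 1}"
proof -
  have "null_rotation a b = mat 1" if "boost t = null_rotation a b" for t a b
    using that by (simp add: boost_def null_rotation_def Let_def matrix_entries mat_def)
  then show ?thesis
    using subgroup.one_closed[OF subgroup_A] subgroup.one_closed[OF subgroup_N]
    by (auto simp: Lorentz_A_eq Lorentz_N_eq)
qed

lemma K_mult_AN: "Lorentz_K <#>\<^bsub>Lorentz\<^esub> Lorentz_AN = carrier Lorentz"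
proof
  show "Lorentz_K <#>\<^bsub>Lorentz\<^esub> Lorentz_AN \<subseteq> carrier Lorentz"
    by (intro Lorentz.setmult_subset_G Lorentz_K_subset subgroup.subset subgroup_AN)
  show "carrier Lorentz \<subseteq> Lorentz_K <#>\<^bsub>Lorentz\<^esub> Lorentz_AN"
  proof
    fix M assume "M \<in> carrier Lorentz"
    then obtain R t a b where "R \<in> special_isometries (mat 1)"
      "M = block 1 R ** (boost t ** null_rotation a b)"
      by (rule Iwasawa_decomposition)
    then show "M \<in> Lorentz_K <#>\<^bsub>Lorentz\<^esub> Lorentz_AN"
      unfolding set_mult_def by (auto simp: Lorentz_K_eq Lorentz_AN_eq) blast
  qed
qed

lemma matched_pair_K_AN: "matched_pair Lorentz Lorentz_K Lorentz_AN"
  using K_Int_AN K_mult_AN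
  by (intro Lorentz.matched_pairI subgroup_K subgroup_AN) simp_all

section \<open>The semidirect product with the translations\<close>

lemma Poinc_simps [simp]:
  "carrier Poinc = carrier Lorentz \<times> UNIV" "(M, s) \<otimes>\<^bsub>Poinc\<^esub> (N, t) = (M ** N, s + M *v t)"
  "\<one>\<^bsub>Poinc\<^esub> = (mat 1, 0)"
  by (simp_all add: Poinc_def semidirect_def R4_def)

lemma Lorentz_inverse:
  assumes "M \<in> carrier Lorentz"
  obtains M' where "M' \<in> carrier Lorentz" "M' ** M = mat 1" "M ** M' = mat 1"
  using assms Lorentz.l_inv Lorentz.r_inv Lorentz.inv_closed that by (metis Lorentz_simps)

interpretation Poinc: group Poinc
proof (rule groupI)
  fix x assume "x \<in> carrier Poinc"
  then obtain M t where x: "x = (M, t)" "M \<in> carrier Lorentz"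
    by auto
  then obtain M' where "M' \<in> carrier Lorentz" "M' ** M = mat 1"
    using Lorentz_inverse by blast
  then show "\<exists>y\<in>carrier Poinc. y \<otimes>\<^bsub>Poinc\<^esub> x = \<one>\<^bsub>Poinc\<^esub>"
    by (intro bexI[of _ "(M', - (M' *v t))"]) (auto simp: x)
next
  show "x \<otimes>\<^bsub>Poinc\<^esub> y \<in> carrier Poinc" if "x \<in> carrier Poinc" "y \<in> carrier Poinc" for x y
    using that Lorentz.m_closed by auto
qed (auto simp: matrix_mul_assoc matrix_vector_right_distrib matrix_vector_mul_assoc)

lemma subgroup_in_Poinc:
  assumes "subgroup S Lorentz"
  shows "subgroup (in_Poinc S) Poinc"
proof (rule Poinc.subgroupI_left_inverse)
  fix x assume "x \<in> in_Poinc S"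
  then obtain M where M: "x = (M, 0)" "M \<in> S" "M \<in> carrier Lorentz"
    using subgroup.subset[OF assms] by (auto simp: in_Poinc_def)
  then show "\<exists>y\<in>in_Poinc S. y \<otimes>\<^bsub>Poinc\<^esub> x = \<one>\<^bsub>Poinc\<^esub>"
    using subgroup.m_inv_closed[OF assms M(2)] Lorentz.l_inv[OF M(3)]
    by (intro bexI[of _ "(inv\<^bsub>Lorentz\<^esub> M, 0)"]) (auto simp: in_Poinc_def)
next
  show "\<one>\<^bsub>Poinc\<^esub> \<in> in_Poinc S"
    using subgroup.one_closed[OF assms] by (simp add: in_Poinc_def)
next
  fix x y assume "x \<in> in_Poinc S" "y \<in> in_Poinc S"
  then show "x \<otimes>\<^bsub>Poinc\<^esub> y \<in> in_Poinc S"
    using subgroup.m_closed[OF assms] by (auto simp: in_Poinc_def)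
qed (use subgroup.subset[OF assms] in \<open>auto simp: in_Poinc_def\<close>)

lemma in_Poinc_mult: "in_Poinc P <#>\<^bsub>Poinc\<^esub> in_Poinc Q = in_Poinc (P <#>\<^bsub>Lorentz\<^esub> Q)"
  by (auto simp: in_Poinc_def set_mult_def) blast+

lemma in_Poinc_Int: "in_Poinc P \<inter> in_Poinc Q = in_Poinc (P \<inter> Q)"
  by (auto simp: in_Poinc_def)

text \<open>This serves both \<open>Lorentz_K\<close> with \<open>Lorentz_AN\<close>, whose product
  is the whole Lorentz group, and \<open>Lorentz_A\<close> with \<open>Lorentz_N\<close>, whose
  product is \<open>Lorentz_AN\<close>.\<close>

lemma matched_pair_in_Poinc:
  assumes "subgroup P Lorentz" "subgroup Q Lorentz" "subgroup (P <#>\<^bsub>Lorentz\<^esub> Q) Lorentz"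
    and "P \<inter> Q = {mat 1}"
  shows "matched_pair (Poinc\<lparr>carrier := in_Poinc (P <#>\<^bsub>Lorentz\<^esub> Q)\<rparr>) (in_Poinc P) (in_Poinc Q)"
proof -
  let ?L = "Poinc\<lparr>carrier := in_Poinc (P <#>\<^bsub>Lorentz\<^esub> Q)\<rparr>"
  have sub: "subgroup (in_Poinc (P <#>\<^bsub>Lorentz\<^esub> Q)) Poinc"
    using assms by (intro subgroup_in_Poinc)
  interpret L: group ?L
    by (rule Poinc.subgroup_imp_group[OF sub])
  have PQ: "P \<subseteq> P <#>\<^bsub>Lorentz\<^esub> Q" "Q \<subseteq> P <#>\<^bsub>Lorentz\<^esub> Q"
    using subgroup.one_closed[OF assms(1)] subgroup.one_closed[OF assms(2)]
    by (force simp: set_mult_def)+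
  show ?thesis
  proof (rule L.matched_pairI)
    show "subgroup (in_Poinc P) ?L" "subgroup (in_Poinc Q) ?L"
      using PQ by (intro Poinc.subgroup_incl subgroup_in_Poinc assms sub; auto simp: in_Poinc_def)+
    show "in_Poinc P \<inter> in_Poinc Q = {\<one>\<^bsub>?L\<^esub>}"
      by (simp add: in_Poinc_Int assms(4)) (simp add: in_Poinc_def)
    show "carrier ?L \<subseteq> in_Poinc P <#>\<^bsub>?L\<^esub> in_Poinc Q"
    proof -
      have "in_Poinc P <#>\<^bsub>?L\<^esub> in_Poinc Q = in_Poinc P <#>\<^bsub>Poinc\<^esub> in_Poinc Q"
        by (simp add: set_mult_def)
      then show ?thesis
        by (simp add: in_Poinc_mult)
    qed
  qed
qed

lemma Poinc_decomposition:
  "group_decomposition Poinc (in_Poinc Lorentz_K) (in_Poinc Lorentz_AN) Poinc_translations"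
proof -
  have KAN: "in_Poinc Lorentz_K <#>\<^bsub>Poinc\<^esub> in_Poinc Lorentz_AN = in_Poinc (carrier Lorentz)"
    by (simp add: in_Poinc_mult K_mult_AN)
  have L: "subgroup (in_Poinc (carrier Lorentz)) Poinc"
    by (intro subgroup_in_Poinc Lorentz.subgroup_self)
  have T: "subgroup Poinc_translations Poinc"
  proof (rule Poinc.subgroupI_left_inverse)
    fix x assume "x \<in> Poinc_translations"
    then show "\<exists>y\<in>Poinc_translations. y \<otimes>\<^bsub>Poinc\<^esub> x = \<one>\<^bsub>Poinc\<^esub>"
      by (intro bexI[of _ "(mat 1, - snd x)"]) (auto simp: Poinc_translations_def)
  qed (auto simp: Poinc_translations_def)
  have normal: "Poinc_translations \<lhd> Poinc"
  proof (rule Poinc.normal_invI[OF T])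
    fix x h assume x: "x \<in> carrier Poinc" and h: "h \<in> Poinc_translations"
    obtain M s where M: "x = (M, s)" by (cases x)
    obtain M' s' where M': "inv\<^bsub>Poinc\<^esub> x = (M', s')" by (cases "inv\<^bsub>Poinc\<^esub> x")
    \<comment> \<open>A conjugate of a translation has linear part M 1 M', and being a translation
      concerns the linear part only.\<close>
    have "M ** M' = mat 1"
      using Poinc.r_inv[OF x] unfolding M' unfolding M by simp
    then show "x \<otimes>\<^bsub>Poinc\<^esub> h \<otimes>\<^bsub>Poinc\<^esub> inv\<^bsub>Poinc\<^esub> x \<in> Poinc_translations"
      unfolding M' using h by (auto simp: M Poinc_translations_def)
  qed
  have comm: "comm_group (Poinc\<lparr>carrier := Poinc_translations\<rparr>)"
    by (rule group.group_comm_groupI[OF Poinc.subgroup_imp_group[OF T]])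
      (auto simp: Poinc_translations_def)
  have "in_Poinc (carrier Lorentz) \<inter> Poinc_translations = {\<one>\<^bsub>Poinc\<^esub>}"
    by (auto simp: in_Poinc_def Poinc_translations_def)
  moreover have "in_Poinc (carrier Lorentz) <#>\<^bsub>Poinc\<^esub> Poinc_translations = carrier Poinc"
  proof
    show "carrier Poinc \<subseteq> in_Poinc (carrier Lorentz) <#>\<^bsub>Poinc\<^esub> Poinc_translations"
    proof
      fix x assume "x \<in> carrier Poinc"
      then obtain M t where x: "x = (M, t)" "M \<in> carrier Lorentz"
        by auto
      then obtain M' where "M ** M' = mat 1"
        using Lorentz_inverse by blast
      \<comment> \<open>The pair applies M before the translation; with the translation as right
        factor, its vector is pulled back through M.\<close>
      then have "x = (M, 0) \<otimes>\<^bsub>Poinc\<^esub> (mat 1, M' *v t)"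
        by (simp add: x matrix_vector_mul_assoc)
      moreover have "(M, 0) \<in> in_Poinc (carrier Lorentz)" "(mat 1, M' *v t) \<in> Poinc_translations"
        using x by (simp_all add: in_Poinc_def Poinc_translations_def)
      ultimately show "x \<in> in_Poinc (carrier Lorentz) <#>\<^bsub>Poinc\<^esub> Poinc_translations"
        unfolding set_mult_def by blast
    qed
  qed (intro Poinc.setmult_subset_G subgroup.subset L T)
  moreover have "matched_pair (Poinc\<lparr>carrier := in_Poinc (carrier Lorentz)\<rparr>)
      (in_Poinc Lorentz_K) (in_Poinc Lorentz_AN)"
    using matched_pair_in_Poinc[OF subgroup_K subgroup_AN _ K_Int_AN]
    by (simp add: K_mult_AN Lorentz.subgroup_self)
  ultimately show ?thesis
    unfolding group_decomposition_def KAN using L normal comm Poinc.is_group by blast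
qed

section \<open>Boundary groups and core\<close>

interpretation P: decomposed_group Poinc "in_Poinc Lorentz_K" "in_Poinc Lorentz_AN" Poinc_translations
  by (rule decomposed_group_of_decomposition[OF Poinc_decomposition])

lemma boundary_groups:
  "hor Poinc_double_group = Poinc\<lparr>carrier := in_Poinc Lorentz_K\<rparr>"
  "ver Poinc_double_group = Poinc\<lparr>carrier := in_Poinc Lorentz_AN\<rparr>"
  by (simp_all add: Poinc_double_group_def decomposition_double_group_def)

lemma isomorphicI:
  assumes "inj_on f (carrier G)" "f ` carrier G = carrier H"
    and "\<And>x y. x \<in> carrier G \<Longrightarrow> y \<in> carrier G \<Longrightarrow> f (x \<otimes>\<^bsub>G\<^esub> y) = f x \<otimes>\<^bsub>H\<^esub> f y"
  shows "G \<cong> H"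
  using assms by (intro is_isoI[of f]) (auto simp: iso_def hom_def bij_betw_def)

lemma translations_iso: "Poinc\<lparr>carrier := Poinc_translations\<rparr> \<cong> R4"
  by (rule isomorphicI[of snd]) (auto simp: Poinc_translations_def R4_def inj_on_def image_iff)

lemma K_iso: "Poinc\<lparr>carrier := in_Poinc Lorentz_K\<rparr> \<cong> SO3"
proof -
  define f :: "affine_map \<Rightarrow> real^3^3" where
    "f = (\<lambda>(M, t). vector [vector [M$2$2, M$2$3, M$2$4], vector [M$3$2, M$3$3, M$3$4],
       vector [M$4$2, M$4$3, M$4$4]])"
  have f: "f (block 1 R, t) = R" for R t
    by (simp add: f_def block_def vec_eq_iff forall_3)
  show ?thesis
    by (rule isomorphicI[of f])
      (auto simp: in_Poinc_def Lorentz_K_eq SO3_def matrix_group_def f block_mult inj_on_def image_iff)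
qed

lemma N_iso: "Poinc\<lparr>carrier := in_Poinc Lorentz_N\<rparr> \<cong> matrix_group Lorentz_N"
  by (rule isomorphicI[of fst]) (auto simp: in_Poinc_def matrix_group_def inj_on_def image_iff)

lemma continuous_on_vector_2 [continuous_intros]:
  fixes a b :: "'a::topological_space \<Rightarrow> 'b::{zero,topological_space}"
  assumes "continuous_on S a" "continuous_on S b"
  shows "continuous_on S (\<lambda>x. vector [a x, b x] :: 'b^2)"
proof -
  have "continuous_on S (\<lambda>x. (vector [a x, b x] :: 'b^2) $ i)" for i
    using exhaust_2[of i] assms by auto
  then have "continuous_on S (\<lambda>x. \<chi> i. (vector [a x, b x] :: 'b^2) $ i)"
    by (intro continuous_on_vec_lambda)
  then show ?thesis by simp
qed

text \<open>The isometries of determinant 1 form a hyperbola p^2 = 1 + r^2. The identity component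
  is its branch p > 0, parametrized by r = sinh t.\<close>

lemma SO11_carrier:
  "carrier SO11 = range (\<lambda>t. vector [vector [cosh t, sinh t], vector [sinh t, cosh t]])"
    (is "_ = range ?b")
proof (intro equalityI subsetI)
  fix M assume "M \<in> carrier SO11"
  then have M: "M \<in> identity_component (special_isometries eta11)"
    by (simp add: SO11_def matrix_group_def)
  have entries: "(y$1$1)\<^sup>2 = 1 + (y$2$1)\<^sup>2" "y$2$2 = y$1$1" "y$1$2 = y$2$1"
    if y: "y \<in> special_isometries eta11" for y
  proof -
    let ?p = "y$1$1" and ?q = "y$1$2" and ?r = "y$2$1" and ?s = "y$2$2"
    have "(transpose y ** eta11 ** y) $ i $ j = eta11 $ i $ j" for i j
      using y by (simp add: special_isometries_def)
    from this[of 1 1] this[of 1 2]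
    have eqs: "?r * ?r = ?p * ?p - 1" "?p * ?q = ?r * ?s"
      by (simp_all add: eta11_def matrix_matrix_mult_def transpose_def sum_2)
    have det: "?p * ?s - ?q * ?r = 1"
      using y by (simp add: special_isometries_def det_2)
    show "?p\<^sup>2 = 1 + ?r\<^sup>2"
      using eqs by (simp add: power2_eq_square)
    \<comment> \<open>Multiplying the determinant relation by p gives p = (p^2 - r^2) s = s, and
      multiplying it by r gives r = (p^2 - r^2) q = q.\<close>
    show "?s = ?p" "?q = ?r"
      using eqs det by algebra+
  qed
  have "y$1$1 \<noteq> 0" if "y \<in> special_isometries eta11" for y
    using entries(1)[OF that] by (metis add_pos_nonneg less_irrefl zero_le_power2 zero_less_one zero_power2)
  then have "M$1$1 > 0"
    using identity_component_pos[OF M] by blast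
  moreover have M': "M \<in> special_isometries eta11"
    using M identity_component_subset by blast
  ultimately have "sqrt (1 + (M$2$1)\<^sup>2) = M$1$1"
    using entries(1)[OF M'] by (intro real_sqrt_unique) auto
  then have "M$1$1 = cosh (arsinh (M$2$1))"
    by (simp add: cosh_arsinh_real add.commute)
  then have "M = ?b (arsinh (M$2$1))"
    using entries(2,3)[OF M'] by (simp add: vec_eq_iff forall_2)
  then show "M \<in> range ?b"
    by blast
next
  fix M assume "M \<in> range ?b"
  then obtain t where t: "M = ?b t"
    by blast
  have "?b t \<in> identity_component (special_isometries eta11)"
  proof (rule identity_component_path[of ?b _ 0])
    show "continuous_on UNIV ?b"
      by (intro continuous_intros)
    have "?b t \<in> special_isometries eta11" for t
    proof -
      have "cosh t * cosh t = 1 + sinh t * sinh t"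
        using cosh_square_eq[of t] by (simp add: power2_eq_square)
      then show ?thesis
        by (simp add: special_isometries_def eta11_def vec_eq_iff forall_2 matrix_matrix_mult_def
            transpose_def sum_2 det_2)
    qed
    then show "range ?b \<subseteq> special_isometries eta11"
      by blast
  qed (simp add: vec_eq_iff forall_2 mat_def)
  then show "M \<in> carrier SO11"
    by (simp add: t SO11_def matrix_group_def)
qed

lemma A_iso: "Poinc\<lparr>carrier := in_Poinc Lorentz_A\<rparr> \<cong> SO11"
proof -
  define f :: "affine_map \<Rightarrow> real^2^2" where
    "f = (\<lambda>(M, t). vector [vector [M$1$1, M$1$2], vector [M$2$1, M$2$2]])"
  have f: "f (boost t, x) = vector [vector [cosh t, sinh t], vector [sinh t, cosh t]]" for t x
    by (simp add: f_def boost_def)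
  have mult: "X \<otimes>\<^bsub>SO11\<^esub> Y = X ** Y" for X Y
    by (simp add: SO11_def matrix_group_def)
  show ?thesis
  proof (rule isomorphicI[of f])
    show "inj_on f (carrier (Poinc\<lparr>carrier := in_Poinc Lorentz_A\<rparr>))"
      by (auto simp: inj_on_def in_Poinc_def Lorentz_A_eq f vec_eq_iff forall_2)
    show "f ` carrier (Poinc\<lparr>carrier := in_Poinc Lorentz_A\<rparr>) = carrier SO11"
      by (auto simp: SO11_carrier in_Poinc_def Lorentz_A_eq f image_iff)
    fix x y
    assume "x \<in> carrier (Poinc\<lparr>carrier := in_Poinc Lorentz_A\<rparr>)"
      "y \<in> carrier (Poinc\<lparr>carrier := in_Poinc Lorentz_A\<rparr>)"
    then obtain s t where "x = (boost s, 0)" "y = (boost t, 0)"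
      by (auto simp: in_Poinc_def Lorentz_A_eq)
    then have "x \<otimes>\<^bsub>Poinc\<lparr>carrier := in_Poinc Lorentz_A\<rparr>\<^esub> y = (boost (s + t), 0)"
      "f x ** f y = f (boost (s + t), 0)"
      by (simp_all add: boost_add f)
        (simp add: vec_eq_iff forall_2 matrix_matrix_mult_def sum_2 cosh_add sinh_add algebra_simps)
    then show "f (x \<otimes>\<^bsub>Poinc\<lparr>carrier := in_Poinc Lorentz_A\<rparr>\<^esub> y) = f x \<otimes>\<^bsub>SO11\<^esub> f y"
      by (simp add: mult)
  qed
qed

theorem mainTheorem2:
  shows "matched_pair Lorentz Lorentz_K Lorentz_AN
       \<and> group_decomposition Poinc (in_Poinc Lorentz_K) (in_Poinc Lorentz_AN) Poinc_translations
       \<and> double_group Poinc_double_group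
       \<and> maximal Poinc_double_group
       \<and> exclusive Poinc_double_group
       \<and> core_group Poinc_double_group \<cong> R4
       \<and> hor Poinc_double_group \<cong> SO3
       \<and> matched_pair (ver Poinc_double_group) (in_Poinc Lorentz_A) (in_Poinc Lorentz_N)
       \<and> ver Poinc_double_group\<lparr>carrier := in_Poinc Lorentz_A\<rparr> \<cong> SO11
       \<and> ver Poinc_double_group\<lparr>carrier := in_Poinc Lorentz_N\<rparr> \<cong> matrix_group Lorentz_N"
proof (intro conjI)
  show "double_group Poinc_double_group" "maximal Poinc_double_group" "exclusive Poinc_double_group"
    unfolding Poinc_double_group_def by (rule P.double_group_D P.maximal_D P.exclusive_D)+
  show "core_group Poinc_double_group \<cong> R4"
    unfolding Poinc_double_group_def by (rule iso_trans[OF P.core_D translations_iso])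
  show "matched_pair (ver Poinc_double_group) (in_Poinc Lorentz_A) (in_Poinc Lorentz_N)"
    using matched_pair_in_Poinc[OF subgroup_A subgroup_N _ A_Int_N] subgroup_AN
    by (simp add: boundary_groups Lorentz_AN_def)
qed (simp_all add: boundary_groups matched_pair_K_AN Poinc_decomposition K_iso A_iso N_iso)

end
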